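(* Assume that $\sum_{n\ge1}\beta_n^\alpha/\gamma_n<\infty$. Then the Ornstein-Uhlenbeck process $X=(X_t^x)_{t\ge0}$ satisfies: (i) for any $x\in H$, $X$ is stochastically continuous (as an $H$-valued process); (ii) for any $x\in H$ and $T>0$, $X$ has trajectories in $L^p(0,T;H)$, for any $0<p<\alpha$, $\mathbb P$-a.s.
   Context: Let $H$ be a real separable (infinite-dimensional) Hilbert space with norm $|\cdot|$ and a fixed orthonormal basis $(e_n)_{n\ge1}$; write $x_n=\langle x,e_n\rangle$. Fix $\alpha\in(0,2)$. $(Z^n_t)_{t\ge0}$, $n\ge1$, are independent real normalized symmetric $\alpha$-stable Lévy processes, $\mathbb E[e^{ihZ^n_t}]=e^{-t|h|^\alpha}$, on a stochastic basis $(\Omega,\mathcal F,(\mathcal F_t)_{t\ge0},\mathbb P)$ satisfying the usual assumptions. $(\beta_n)$ is a sequence of positive reals. $A:D(A)\subset H\to H$ is self-adjoint with $e_n\in D(A)$, $Ae_n=-\gamma_ne_n$, $\gamma_n>0$, $\gamma_n\to+\infty$. The Ornstein-Uhlenbeck process starting from $x\in H$ (solution of $dX_t=AX_tdt+dZ_t$, $X_0=x$, with $Z_t=\sum_n\beta_nZ_t^ne_n$) is $X_t^x=\sum_{n\ge1}X_t^ne_n$, $X_t^n=e^{-\gamma_nt}x_n+\int_0^te^{-\gamma_n(t-s)}\beta_n\,dZ^n_s$; under $\sum_n\beta_n^\alpha/\gamma_n<\infty$ it is $H$-valued. For statements about trajectories, a version of $X$ that is jointly measurable in $(t,\omega)$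 is considered. For any $p>0$, $L^p(0,T;H)$ is the space of (classes of) measurable $f:(0,T)\to H$ with $\int_0^T|f(t)|^pdt<\infty$. *)

theory Defs
  imports "HOL-Probability.Probability"
begin

section \<open>The Hilbert space and the operator\<close>

text \<open>
  A real separable Hilbert space is a type of sort \<open>{real_inner, polish_space}\<close>: for a metric
  space, second countability is separability. The basis is indexed by \<open>nat\<close>, starting at \<open>0\<close>, so
  the space is infinite-dimensional.
\<close>

definition orthonormal_basis :: "(nat \<Rightarrow> 'h::real_inner) \<Rightarrow> bool" where
  "orthonormal_basis e \<longleftrightarrow>
     (\<forall>m n. e m \<bullet> e n = (if m = n then 1 else 0)) \<and> closure (span (range e)) = UNIV"

text \<open>
  A possibly unbounded operator with domain \<open>D\<close>; values of \<open>A\<close> outside \<open>D\<close> are irrelevant. The last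
  conjunct says that \<open>D(A\<^sup>*) = D\<close> and \<open>A\<^sup>* = A\<close>.
\<close>

definition self_adjoint_operator :: "'h::real_inner set \<Rightarrow> ('h \<Rightarrow> 'h) \<Rightarrow> bool" where
  "self_adjoint_operator D A \<longleftrightarrow>
     subspace D \<and> closure D = UNIV \<and>
     (\<forall>x\<in>D. \<forall>y\<in>D. A (x + y) = A x + A y) \<and>
     (\<forall>c. \<forall>x\<in>D. A (c *\<^sub>R x) = c *\<^sub>R A x) \<and>
     (\<forall>y z. (\<forall>x\<in>D. A x \<bullet> y = x \<bullet> z) \<longleftrightarrow> y \<in> D \<and> A y = z)"


section \<open>Stochastic basis and processes\<close>

text \<open>Time is \<open>[0, \<infinity>)\<close>: processes are indexed by \<open>real\<close> and only \<open>t \<ge> 0\<close> matters.\<close>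

definition stochastic_basis :: "'w measure \<Rightarrow> (real \<Rightarrow> 'w measure) \<Rightarrow> bool" where
  "stochastic_basis M F \<longleftrightarrow>
     prob_space M \<and>
     (\<forall>t\<ge>0. subalgebra M (F t)) \<and>
     (\<forall>s\<ge>0. \<forall>t\<ge>s. sets (F s) \<subseteq> sets (F t)) \<and>
     \<comment> \<open>usual assumptions: completeness and right-continuity\<close>
     (\<forall>N\<in>null_sets M. \<forall>B\<subseteq>N. B \<in> sets (F 0)) \<and>
     (\<forall>t\<ge>0. sets (F t) = (\<Inter>s\<in>{t<..}. sets (F s)))"

definition stochastically_continuous ::
    "'w measure \<Rightarrow> (real \<Rightarrow> 'w \<Rightarrow> 'a::metric_space) \<Rightarrow> bool" where
  "stochastically_continuous M X \<longleftrightarrow>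
     (\<forall>t\<ge>0. \<forall>\<epsilon>>0.
        ((\<lambda>s. \<P>(\<omega> in M. dist (X s \<omega>) (X t \<omega>) > \<epsilon>)) \<longlongrightarrow> 0) (at t within {0..}))"

definition cadlag :: "(real \<Rightarrow> 'a::topological_space) \<Rightarrow> bool" where
  "cadlag f \<longleftrightarrow>
     (\<forall>t\<ge>0. (f \<longlongrightarrow> f t) (at_right t)) \<and> (\<forall>t>0. \<exists>l. (f \<longlongrightarrow> l) (at_left t))"

definition levy_process ::
    "'w measure \<Rightarrow> (real \<Rightarrow> 'w measure) \<Rightarrow> (real \<Rightarrow> 'w \<Rightarrow> real) \<Rightarrow> bool" where
  "levy_process M F Z \<longleftrightarrow>
     (\<forall>t\<ge>0. Z t \<in> borel_measurable (F t)) \<and>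
     (AE \<omega> in M. Z 0 \<omega> = 0) \<and>
     (\<forall>s\<ge>0. \<forall>t\<ge>s. prob_space.indep_set M (sets (F s))
        {(\<lambda>\<omega>. Z t \<omega> - Z s \<omega>) -` B \<inter> space M | B. B \<in> sets borel}) \<and>
     (\<forall>s\<ge>0. \<forall>t\<ge>s. distr M borel (\<lambda>\<omega>. Z t \<omega> - Z s \<omega>) = distr M borel (Z (t - s))) \<and>
     stochastically_continuous M Z \<and>
     (AE \<omega> in M. cadlag (\<lambda>t. Z t \<omega>))"

definition normalized_stable_levy ::
    "real \<Rightarrow> 'w measure \<Rightarrow> (real \<Rightarrow> 'w measure) \<Rightarrow> (real \<Rightarrow> 'w \<Rightarrow> real) \<Rightarrow> bool" where
  "normalized_stable_levy \<alpha> M F Z \<longleftrightarrow>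
     levy_process M F Z \<and>
     (\<forall>t\<ge>0. \<forall>h. char (distr M borel (Z t)) h = complex_of_real (exp (- t * \<bar>h\<bar> powr \<alpha>)))"

text \<open>Independence of whole processes, as random variables with values in \<open>\<real>\<^bsup>[0,\<infinity>)\<^esup>\<close>.\<close>

definition independent_processes ::
    "'w measure \<Rightarrow> (nat \<Rightarrow> real \<Rightarrow> 'w \<Rightarrow> real) \<Rightarrow> bool" where
  "independent_processes M Z \<longleftrightarrow>
     prob_space.indep_vars M (\<lambda>_. \<Pi>\<^sub>M t\<in>{0..}. borel) (\<lambda>n \<omega>. \<lambda>t\<in>{0..}. Z n t \<omega>) UNIV"


section \<open>The Ornstein-Uhlenbeck process\<close>

text \<open>
  For a deterministic continuous integrand \<open>f\<close>, the stochastic integral of \<open>f\<close> against \<open>Z\<close> over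
  \<open>[a, b]\<close> is the limit in probability of the left-point Riemann sums as the mesh of the partition
  tends to \<open>0\<close>. It is determined up to almost sure equality, hence a relation.
\<close>

definition has_stochastic_integral ::
    "'w measure \<Rightarrow> (real \<Rightarrow> 'w \<Rightarrow> real) \<Rightarrow> (real \<Rightarrow> real) \<Rightarrow> real \<Rightarrow> real \<Rightarrow> ('w \<Rightarrow> real) \<Rightarrow> bool" where
  "has_stochastic_integral M Z f a b I \<longleftrightarrow>
     I \<in> borel_measurable M \<and>
     (\<forall>\<epsilon>>0. \<exists>\<delta>>0. \<forall>N. \<forall>p :: nat \<Rightarrow> real.
        p 0 = a \<and> p N = b \<and> (\<forall>i<N. p i \<le> p (Suc i) \<and> p (Suc i) - p i < \<delta>) \<longrightarrow>
        \<P>(\<omega> in M. \<bar>(\<Sum>i<N. f (p i) * (Z (p (Suc i)) \<omega> - Z (p i) \<omega>)) - I \<omega>\<bar> > \<epsilon>) < \<epsilon>)"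

text \<open>
  \<open>X\<close> is (a version of) the process started at \<open>x\<close>: for each \<open>t \<ge> 0\<close>, almost surely
  \<open>X\<^sub>t = \<Sum>\<^sub>n X\<^sub>t\<^sup>n e\<^sub>n\<close>. Convergence of the series is not part of the definition.
\<close>

definition ou_process ::
    "'w measure \<Rightarrow> (nat \<Rightarrow> 'h::real_inner) \<Rightarrow> (nat \<Rightarrow> real) \<Rightarrow> (nat \<Rightarrow> real) \<Rightarrow>
     (nat \<Rightarrow> real \<Rightarrow> 'w \<Rightarrow> real) \<Rightarrow> 'h \<Rightarrow> (real \<Rightarrow> 'w \<Rightarrow> 'h) \<Rightarrow> bool" where
  "ou_process M e \<gamma> \<beta> Z x X \<longleftrightarrow>
     (\<forall>t\<ge>0. X t \<in> borel_measurable M) \<and>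
     (\<exists>I. (\<forall>n. \<forall>t\<ge>0.
             has_stochastic_integral M (Z n) (\<lambda>s. exp (- \<gamma> n * (t - s)) * \<beta> n) 0 t (I n t)) \<and>
          (\<forall>t\<ge>0. AE \<omega> in M.
             X t \<omega> = (\<Sum>n. (exp (- \<gamma> n * t) * (x \<bullet> e n) + I n t \<omega>) *\<^sub>R e n)))"

definition jointly_measurable ::
    "'w measure \<Rightarrow> (real \<Rightarrow> 'w \<Rightarrow> 'a::topological_space) \<Rightarrow> bool" where
  "jointly_measurable M X \<longleftrightarrow>
     (\<lambda>(t, \<omega>). X t \<omega>) \<in> borel_measurable (restrict_space borel {0..} \<Otimes>\<^sub>M M)"

text \<open>Representatives of the elements of \<open>L\<^sup>p(0, T; H)\<close>.\<close>

definition Lp_interval :: "real \<Rightarrow> real \<Rightarrow> (real \<Rightarrow> 'h::real_normed_vector) set" where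
  "Lp_interval p T = {f. f \<in> borel_measurable (restrict_space lborel {0<..<T}) \<and>
     (\<integral>\<^sup>+t\<in>{0<..<T}. ennreal (norm (f t) powr p) \<partial>lborel) < \<infinity>}"

end

theory Submission
  imports Defs
begin

text \<open>
  With \<open>G y = min 1 (y\<^sup>2)\<close>, a variable with characteristic function \<open>exp (- c \<bar>h\<bar>\<^sup>\<alpha>)\<close> satisfies
  \<open>E (G (Y / r)) \<le> 8 c r\<^sup>-\<^sup>\<alpha>\<close>, and Riemann sums of a stochastic integral are of this kind with
  \<open>c = \<Sum> \<bar>f (p\<^sub>i)\<bar>\<^sup>\<alpha> (p\<^sub>i\<^sub>+\<^sub>1 - p\<^sub>i)\<close>; since \<open>G\<close> is bounded and Lipschitz, the estimate passes to limits
  in probability. If \<open>\<Sum> Y\<^sub>n\<^sup>2 > r\<^sup>2\<close> then \<open>\<Sum> G (Y\<^sub>n / r) \<ge> 1\<close>, so Markov's inequality bounds the tail of the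
  Hilbert norm by the sum of the coordinate estimates. Applied to the stochastic convolution this gives
  \<open>P (\<bar>X\<^sub>t\<bar> > r) \<le> C r\<^sup>-\<^sup>\<alpha>\<close> with \<open>C\<close> independent of \<open>t\<close>, hence \<open>sup\<^sub>t E \<bar>X\<^sub>t\<bar>\<^sup>p < \<infinity>\<close> for \<open>p < \<alpha>\<close>, and Fubini's
  theorem yields (ii). Applied to increments it gives (i), because each coordinate estimate tends to
  \<open>0\<close> and they are dominated by the summable sequence \<open>\<beta>\<^sub>n\<^sup>\<alpha> / \<gamma>\<^sub>n\<close>.
\<close>

section \<open>Truncated squares of stable variables\<close>

definition trunc_sq :: "real \<Rightarrow> real" where
  "trunc_sq y = min 1 (y\<^sup>2)"

lemma trunc_sq_nonneg [simp]: "0 \<le> trunc_sq y"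
  by (simp add: trunc_sq_def)

lemma trunc_sq_le_1: "trunc_sq y \<le> 1"
  by (simp add: trunc_sq_def)

lemma trunc_sq_zero [simp]: "trunc_sq 0 = 0"
  by (simp add: trunc_sq_def)

lemma trunc_sq_minus [simp]: "trunc_sq (- y) = trunc_sq y"
  by (simp add: trunc_sq_def)

lemma measurable_trunc_sq [measurable]: "trunc_sq \<in> borel_measurable borel"
  unfolding trunc_sq_def by measurable

lemma trunc_sq_eq: "trunc_sq y = (min 1 \<bar>y\<bar>)\<^sup>2"
proof (cases "\<bar>y\<bar> \<le> 1")
  case True
  then have "y\<^sup>2 \<le> 1" by (simp add: abs_square_le_1)
  with True show ?thesis by (simp add: trunc_sq_def min_absorb2)
next
  case False
  then have "\<not> y\<^sup>2 \<le> 1" by (simp add: abs_square_le_1)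
  with False show ?thesis by (simp add: trunc_sq_def)
qed

text \<open>The map \<open>\<lambda>y. min 1 \<bar>y\<bar>\<close> is 1-Lipschitz with values in
  [0, 1], and the squares of two such values differ by at most twice their distance. This is what
  lets truncated moments survive limits in probability.\<close>

lemma trunc_sq_lipschitz: "trunc_sq a \<le> trunc_sq b + 2 * \<bar>a - b\<bar>"
proof -
  define u v where "u = min 1 \<bar>a\<bar>" and "v = min 1 \<bar>b\<bar>"
  have uv: "0 \<le> u" "u \<le> 1" "0 \<le> v" "v \<le> 1" "\<bar>u - v\<bar> \<le> \<bar>a - b\<bar>"
    by (auto simp: u_def v_def)
  have "u\<^sup>2 - v\<^sup>2 = (u - v) * (u + v)"
    by (simp add: power2_eq_square algebra_simps)
  also have "\<dots> \<le> \<bar>u - v\<bar> * (u + v)"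
    using uv by (intro mult_right_mono) auto
  also have "\<dots> \<le> \<bar>a - b\<bar> * 2"
    using uv by (intro mult_mono) auto
  finally show ?thesis
    by (simp add: trunc_sq_eq u_def v_def)
qed

text \<open>For \<open>0 < y \<le> 2\<close> Taylor's formula for the sine suffices. Beyond 2 the
  left side is at most 1, while \<open>sin y / y \<le> 1 / 2\<close>. Both sides are even, which
  settles negative y.\<close>

lemma trunc_sq_le_sinc:
  assumes "y \<noteq> 0"
  shows "trunc_sq y \<le> 8 * (1 - sin y / y)"
proof -
  have pos: "trunc_sq y \<le> 8 * (1 - sin y / y)" if y: "0 < y" for y :: real
  proof (cases "y \<le> 2")
    case True
    have "\<bar>sin y - (\<Sum>m<5. sin_coeff m * y ^ m)\<bar> \<le> inverse (fact 5) * \<bar>y\<bar> ^ 5"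
      by (rule Maclaurin_sin_bound)
    moreover have "(\<Sum>m<5. sin_coeff m * y ^ m) = y - y ^ 3 / 6"
      by (simp add: lessThan_nat_numeral sin_coeff_def fact_numeral power3_eq_cube)
    ultimately have "sin y \<le> y - y ^ 3 / 6 + y ^ 5 / 120"
      using y by (simp add: fact_numeral divide_simps abs_if split: if_splits)
    then have "sin y / y \<le> (y - y ^ 3 / 6 + y ^ 5 / 120) / y"
      using y by (intro divide_right_mono) auto
    also have "\<dots> = 1 - y\<^sup>2 / 6 + y\<^sup>2 * y\<^sup>2 / 120"
      using y by (simp add: field_simps eval_nat_numeral)
    \<comment> \<open>Since \<open>y\<^sup>2 \<le> 4\<close>, the quartic term is at most
      \<open>y\<^sup>2 / 30\<close>, and 1/6 - 1/30 = 2/15 exceeds 1/8. This is the source of the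
      constant 8.\<close>
    also have "y\<^sup>2 * y\<^sup>2 \<le> y\<^sup>2 * 4"
    proof (rule mult_left_mono)
      show "y\<^sup>2 \<le> 4" using True y power_mono[of y 2 2] by simp
    qed simp
    finally have "sin y / y \<le> 1 - y\<^sup>2 / 8"
      using zero_le_power2[of y] by linarith
    then show ?thesis by (simp add: trunc_sq_def)
  next
    case False
    then have "sin y * 2 \<le> y"
      using sin_le_one[of y] by linarith
    then have "sin y / y \<le> 1 / 2"
      using y by (simp add: field_simps)
    then have "1 \<le> 8 * (1 - sin y / y)"
      by (simp add: right_diff_distrib)
    with trunc_sq_le_1[of y] show ?thesis by (rule order_trans)
  qed
  show ?thesis
  proof (cases "0 < y")
    case True
    then show ?thesis by (rule pos)
  next
    case False
    then show ?thesis using assms pos[of "- y"] by simp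
  qed
qed

text \<open>Links the sine quotient to characteristic functions: once the integrals over h and over
  the probability space are exchanged, only the mean of the cosine is left to compute.\<close>

lemma nn_integral_one_minus_cos:
  "(\<integral>\<^sup>+h. ennreal (1 - cos (h * y)) * indicator {0..1} h \<partial>lborel) = ennreal (1 - sin y / y)"
  if "y \<noteq> 0"
proof -
  have "(\<integral>\<^sup>+h. ennreal (1 - cos (h * y)) * indicator {0..1} h \<partial>lborel)
      = ennreal ((1 - sin (1 * y) / y) - (0 - sin (0 * y) / y))"
    using that
    by (intro nn_integral_FTC_Icc[where F = "\<lambda>h. h - sin (h * y) / y"])
      (auto intro!: derivative_eq_intros)
  then show ?thesis by simp
qed

text \<open>Averaging \<open>1 - cos (h X)\<close> over \<open>h \<in> [0, 1]\<close> dominates the truncated square of \<open>X\<close>,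
  while its expectation is read off the characteristic function.\<close>

lemma (in prob_space) nn_integral_trunc_sq_stable:
  assumes [measurable]: "X \<in> borel_measurable M"
    and char: "\<And>h. char (distr M borel X) h = complex_of_real (exp (- c * \<bar>h\<bar> powr \<alpha>))"
    and "0 \<le> c" "0 < \<alpha>"
  shows "(\<integral>\<^sup>+\<omega>. ennreal (trunc_sq (X \<omega>)) \<partial>M) \<le> ennreal (8 * c)"
proof -
  interpret pair_sigma_finite lborel M
    by unfold_locales
  have "(\<integral>\<^sup>+\<omega>. ennreal (trunc_sq (X \<omega>)) \<partial>M)
      \<le> (\<integral>\<^sup>+\<omega>. \<integral>\<^sup>+h. 8 * (ennreal (1 - cos (h * X \<omega>)) * indicator {0..1} h) \<partial>lborel \<partial>M)"
  proof (rule nn_integral_mono)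
    fix \<omega>
    show "ennreal (trunc_sq (X \<omega>))
        \<le> (\<integral>\<^sup>+h. 8 * (ennreal (1 - cos (h * X \<omega>)) * indicator {0..1} h) \<partial>lborel)"
    \<comment> \<open>At 0 the truncated square vanishes; elsewhere the division is meaningful and
      the closed form of the inner integral applies.\<close>
    proof (cases "X \<omega> = 0")
      case False
      then have "ennreal (trunc_sq (X \<omega>)) \<le> ennreal (8 * (1 - sin (X \<omega>) / X \<omega>))"
        by (intro ennreal_leI trunc_sq_le_sinc)
      also have "\<dots> = 8 * ennreal (1 - sin (X \<omega>) / X \<omega>)"
        by (subst ennreal_mult') auto
      also have "\<dots> = (\<integral>\<^sup>+h. 8 * (ennreal (1 - cos (h * X \<omega>)) * indicator {0..1} h) \<partial>lborel)"
        using False by (subst nn_integral_cmult) (auto simp: nn_integral_one_minus_cos)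
      finally show ?thesis .
    qed simp
  qed
  also have "\<dots> = (\<integral>\<^sup>+h. \<integral>\<^sup>+\<omega>. 8 * (ennreal (1 - cos (h * X \<omega>)) * indicator {0..1} h) \<partial>M \<partial>lborel)"
    by (rule Fubini') measurable
  also have "\<dots> \<le> (\<integral>\<^sup>+h. ennreal (8 * c) * indicator {0..1::real} h \<partial>lborel)"
  proof (rule nn_integral_mono)
    fix h :: real
    have int: "integrable M (\<lambda>\<omega>. iexp (h * X \<omega>))"
      by (intro integrable_const_bound[where B = 1]) auto
    have "complex_of_real (exp (- c * \<bar>h\<bar> powr \<alpha>)) = (CLINT \<omega>|M. iexp (h * X \<omega>))"
      unfolding char[symmetric] char_def by (subst integral_distr) auto
    \<comment> \<open>The characteristic function is real, so taking real parts yields the mean of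
      the cosine.\<close>
    then have "exp (- c * \<bar>h\<bar> powr \<alpha>) = Re (CLINT \<omega>|M. iexp (h * X \<omega>))"
      by (metis Re_complex_of_real)
    also have "\<dots> = (\<integral>\<omega>. cos (h * X \<omega>) \<partial>M)"
      using int by (subst integral_Re[symmetric]) (auto simp: Re_exp)
    finally have cos: "(\<integral>\<omega>. cos (h * X \<omega>) \<partial>M) = exp (- c * \<bar>h\<bar> powr \<alpha>)" ..
    have intc: "integrable M (\<lambda>\<omega>. cos (h * X \<omega>))"
      by (intro integrable_const_bound[where B = 1]) auto
    have "(\<integral>\<^sup>+\<omega>. 8 * ennreal (1 - cos (h * X \<omega>)) \<partial>M)
        = 8 * (\<integral>\<^sup>+\<omega>. ennreal (1 - cos (h * X \<omega>)) \<partial>M)"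
      by (subst nn_integral_cmult) auto
    also have "(\<integral>\<^sup>+\<omega>. ennreal (1 - cos (h * X \<omega>)) \<partial>M) = ennreal (1 - exp (- c * \<bar>h\<bar> powr \<alpha>))"
      using intc by (subst nn_integral_eq_integral) (auto simp: cos prob_space)
    also have "8 * \<dots> = ennreal (8 * (1 - exp (- c * \<bar>h\<bar> powr \<alpha>)))"
      by (subst ennreal_mult') auto
    \<comment> \<open>This is \<open>1 - exp (- u) \<le> u\<close>. On [0, 1] the remaining power of
      h is at most 1 because \<alpha> is positive, which leaves \<open>8 * c\<close>.\<close>
    also have "\<dots> \<le> ennreal (8 * (c * \<bar>h\<bar> powr \<alpha>))"
      using exp_ge_add_one_self[of "- c * \<bar>h\<bar> powr \<alpha>"] by (intro ennreal_leI) auto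
    finally have le: "(\<integral>\<^sup>+\<omega>. 8 * ennreal (1 - cos (h * X \<omega>)) \<partial>M) \<le> ennreal (8 * (c * \<bar>h\<bar> powr \<alpha>))" .
    have "ennreal (8 * (c * \<bar>h\<bar> powr \<alpha>)) \<le> ennreal (8 * c)" if "h \<in> {0..1}"
    proof -
      have "\<bar>h\<bar> powr \<alpha> \<le> 1 powr \<alpha>"
        using that \<open>0 < \<alpha>\<close> by (intro powr_mono2) auto
      then show ?thesis
        using \<open>0 \<le> c\<close> by (intro ennreal_leI) (simp add: mult_left_le)
    qed
    with le show "(\<integral>\<^sup>+\<omega>. 8 * (ennreal (1 - cos (h * X \<omega>)) * indicator {0..1} h) \<partial>M)
        \<le> ennreal (8 * c) * indicator {0..1} h"
      by (auto split: split_indicator)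
  qed
  also have "\<dots> = ennreal (8 * c)"
    by (subst nn_integral_cmult) auto
  finally show ?thesis .
qed

section \<open>Stochastic integrals against a stable process\<close>

text \<open>One real coordinate of the noise; instantiated later for every
  \<open>Z n\<close>.\<close>

locale stable_levy = prob_space M for M :: "'w measure" +
  fixes F :: "real \<Rightarrow> 'w measure" and Z :: "real \<Rightarrow> 'w \<Rightarrow> real" and \<alpha> :: real
  assumes basis: "stochastic_basis M F"
    and stable: "normalized_stable_levy \<alpha> M F Z"
    and alpha_pos: "0 < \<alpha>"
begin

lemma subalg:
  assumes "0 \<le> t"
  shows "subalgebra M (F t)"
proof -
  have "\<forall>t\<ge>0. subalgebra M (F t)"
    using basis unfolding stochastic_basis_def by (elim conjE)
  with assms show ?thesis by simp
qed

lemma space_F: "0 \<le> t \<Longrightarrow> space (F t) = space M"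
  using subalg[of t] by (simp add: subalgebra_def)

lemma filtration_mono: "0 \<le> s \<Longrightarrow> s \<le> t \<Longrightarrow> sets (F s) \<subseteq> sets (F t)"
proof -
  have *: "\<forall>s\<ge>0. \<forall>t\<ge>s. sets (F s) \<subseteq> sets (F t)"
    using basis unfolding stochastic_basis_def by (elim conjE)
  show "0 \<le> s \<Longrightarrow> s \<le> t \<Longrightarrow> sets (F s) \<subseteq> sets (F t)"
    using * by simp
qed

lemma measurable_mono:
  fixes f :: "'w \<Rightarrow> real"
  assumes "f \<in> borel_measurable (F s)" "0 \<le> s" "s \<le> t"
  shows "f \<in> borel_measurable (F t)"
  using assms filtration_mono[of s t] space_F[of s] space_F[of t] unfolding measurable_def by auto

lemma levy:
  "\<forall>t\<ge>0. Z t \<in> borel_measurable (F t)"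
  "\<forall>s\<ge>0. \<forall>t\<ge>s. indep_set (sets (F s))
        {(\<lambda>\<omega>. Z t \<omega> - Z s \<omega>) -` B \<inter> space M | B. B \<in> sets borel}"
  "\<forall>s\<ge>0. \<forall>t\<ge>s. distr M borel (\<lambda>\<omega>. Z t \<omega> - Z s \<omega>) = distr M borel (Z (t - s))"
  using stable unfolding normalized_stable_levy_def levy_process_def by - (elim conjE, assumption)+

lemma adapted:
  assumes "0 \<le> s" "s \<le> t"
  shows "Z s \<in> borel_measurable (F t)"
  using assms levy(1) by (intro measurable_mono[of "Z s" s t]) auto

lemma measurable_of_adapted:
  assumes "f \<in> borel_measurable (F t)" "0 \<le> t"
  shows "f \<in> borel_measurable M"
  using measurable_from_subalg[OF subalg[OF assms(2)] assms(1)] .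

lemma measurable_Z: "0 \<le> t \<Longrightarrow> Z t \<in> borel_measurable M"
  using levy(1) measurable_of_adapted[of "Z t" t] by simp

text \<open>Stationarity replaces the increment by \<open>Z (t - s)\<close>, and the weight w moves
  into the argument of the characteristic function, from which it emerges as
  \<open>\<bar>w\<bar> powr \<alpha>\<close>.\<close>

lemma char_increment:
  assumes "0 \<le> s" "s \<le> t"
  shows "char (distr M borel (\<lambda>\<omega>. w * (Z t \<omega> - Z s \<omega>))) h
    = complex_of_real (exp (- (\<bar>w\<bar> powr \<alpha> * (t - s)) * \<bar>h\<bar> powr \<alpha>))"
proof -
  have [measurable]: "Z t \<in> borel_measurable M" "Z s \<in> borel_measurable M"
    using assms by (auto intro: measurable_Z)
  have "char (distr M borel (\<lambda>\<omega>. w * (Z t \<omega> - Z s \<omega>))) h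
      = char (distr M borel (\<lambda>\<omega>. Z t \<omega> - Z s \<omega>)) (w * h)"
    unfolding char_def by (subst (1 2) integral_distr) (auto simp: mult_ac)
  also have "distr M borel (\<lambda>\<omega>. Z t \<omega> - Z s \<omega>) = distr M borel (Z (t - s))"
    using levy assms by auto
  also have "char \<dots> (w * h) = complex_of_real (exp (- (t - s) * \<bar>w * h\<bar> powr \<alpha>))"
    using stable assms unfolding normalized_stable_levy_def by (elim conjE) (simp add: algebra_simps)
  finally show ?thesis
    by (simp add: abs_mult powr_mult algebra_simps)
qed

text \<open>The Levy property states independence of the increment from \<open>F s\<close>. The
  \<sigma>-algebra generated by Y lies inside \<open>F s\<close>, so independence is inherited, and
  multiplication by w preserves it.\<close>

lemma indep_increment:
  assumes "0 \<le> s" "s \<le> t" and Y: "Y \<in> borel_measurable (F s)"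
  shows "indep_var borel Y borel (\<lambda>\<omega>. w * (Z t \<omega> - Z s \<omega>))"
proof -
  have [measurable]: "Z t \<in> borel_measurable M" "Z s \<in> borel_measurable M"
    using assms by (auto intro: measurable_Z)
  have YM [measurable]: "Y \<in> borel_measurable M"
    using Y assms(1) by (rule measurable_of_adapted)
  let ?D = "\<lambda>\<omega>. Z t \<omega> - Z s \<omega>"
  have ind: "indep_set (sets (F s)) {?D -` B \<inter> space M | B. B \<in> sets borel}"
    using levy assms by auto
  \<comment> \<open>Preimages of Borel sets under one map already form a \<sigma>-algebra, so
    generating adds nothing.\<close>
  have sig: "sigma_sets (space M) {?D -` B \<inter> space M | B. B \<in> sets borel}
      = {?D -` B \<inter> space M | B. B \<in> sets borel}"
    using sets_vimage_algebra[of "space M" ?D borel] sets_vimage_algebra2[of ?D "space M" borel]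
    by simp
  have "sigma_sets (space M) {Y -` A \<inter> space M |A. A \<in> sets borel} \<subseteq> sets (F s)"
  proof -
    have "{Y -` A \<inter> space M |A. A \<in> sets borel} \<subseteq> sets (F s)"
      using measurable_sets[OF Y] space_F[of s] assms by auto
    then show ?thesis
      using sets.sigma_sets_subset[of _ "F s"] space_F[of s] assms by auto
  qed
  then have "indep_set (sigma_sets (space M) {Y -` A \<inter> space M |A. A \<in> sets borel})
      {?D -` B \<inter> space M | B. B \<in> sets borel}"
    using ind unfolding indep_sets2_eq by blast
  then have "indep_var borel Y borel ?D"
    unfolding indep_var_eq sig by simp
  from indep_var_compose[OF this, of "\<lambda>x. x" borel "\<lambda>x. w * x" borel]
  show ?thesis by (simp add: comp_def)
qed

text \<open>Induction on N. The three claims travel together: measurability at time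
  \<open>p N\<close> makes the partial sum independent of the next increment, nonnegativity of
  \<open>p N\<close> places that increment in the time range, and then characteristic functions
  multiply, so exponents add.\<close>

lemma weighted_increments:
  assumes "0 \<le> p 0" and "\<And>i. i < N \<Longrightarrow> p i \<le> p (Suc i)"
  shows "(\<lambda>\<omega>. \<Sum>i<N. w i * (Z (p (Suc i)) \<omega> - Z (p i) \<omega>)) \<in> borel_measurable (F (p N))
    \<and> char (distr M borel (\<lambda>\<omega>. \<Sum>i<N. w i * (Z (p (Suc i)) \<omega> - Z (p i) \<omega>))) h
      = complex_of_real (exp (- (\<Sum>i<N. \<bar>w i\<bar> powr \<alpha> * (p (Suc i) - p i)) * \<bar>h\<bar> powr \<alpha>))
    \<and> 0 \<le> p N"
  using assms(2)
proof (induction N)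
  case 0
  have "char (distr M borel (\<lambda>_. 0)) h = 1"
    unfolding char_def by (subst integral_distr) (auto simp: prob_space)
  with assms(1) show ?case by simp
next
  case (Suc N)
  let ?S = "\<lambda>\<omega>. \<Sum>i<N. w i * (Z (p (Suc i)) \<omega> - Z (p i) \<omega>)"
  have meas: "?S \<in> borel_measurable (F (p N))" and pN: "0 \<le> p N" "p N \<le> p (Suc N)"
    using Suc by auto
  have meas': "?S \<in> borel_measurable (F (p (Suc N)))"
    using meas pN by (rule measurable_mono)
  have "Z (p (Suc N)) \<in> borel_measurable (F (p (Suc N)))" "Z (p N) \<in> borel_measurable (F (p (Suc N)))"
    using pN by (auto intro: adapted)
  with meas' have "(\<lambda>\<omega>. \<Sum>i<Suc N. w i * (Z (p (Suc i)) \<omega> - Z (p i) \<omega>)) \<in> borel_measurable (F (p (Suc N)))"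
    by simp
  moreover have "char (distr M borel (\<lambda>\<omega>. ?S \<omega> + w N * (Z (p (Suc N)) \<omega> - Z (p N) \<omega>))) h
      = char (distr M borel ?S) h * char (distr M borel (\<lambda>\<omega>. w N * (Z (p (Suc N)) \<omega> - Z (p N) \<omega>))) h"
    using pN meas by (intro char_distr_add indep_increment)
  moreover have "char (distr M borel ?S) h
      = complex_of_real (exp (- (\<Sum>i<N. \<bar>w i\<bar> powr \<alpha> * (p (Suc i) - p i)) * \<bar>h\<bar> powr \<alpha>))"
    using Suc by auto
  moreover have "exp (- a * c) * exp (- b * c) = exp (- (a + b) * c)" for a b c :: real
    by (simp add: exp_add[symmetric] algebra_simps)
  ultimately show ?case
    using pN by (simp only: char_increment sum.lessThan_Suc of_real_mult[symmetric]) auto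
qed

text \<open>Dividing by r rescales all weights, and the scale parameter of a stable law is
  homogeneous of degree \<alpha> in the weights; hence the factor
  \<open>r powr - \<alpha>\<close>.\<close>

lemma nn_integral_weighted_increments:
  assumes "0 \<le> p 0" and mono: "\<And>i. i < N \<Longrightarrow> p i \<le> p (Suc i)" and "0 < r"
  shows "(\<integral>\<^sup>+\<omega>. ennreal (trunc_sq ((\<Sum>i<N. w i * (Z (p (Suc i)) \<omega> - Z (p i) \<omega>)) / r)) \<partial>M)
    \<le> ennreal (8 * (r powr - \<alpha> * (\<Sum>i<N. \<bar>w i\<bar> powr \<alpha> * (p (Suc i) - p i))))"
proof -
  let ?S = "\<lambda>\<omega>. \<Sum>i<N. w i / r * (Z (p (Suc i)) \<omega> - Z (p i) \<omega>)"
  note * = weighted_increments[OF assms(1) mono, where w = "\<lambda>i. w i / r"]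
  have eq: "(\<Sum>i<N. \<bar>w i / r\<bar> powr \<alpha> * (p (Suc i) - p i))
      = r powr - \<alpha> * (\<Sum>i<N. \<bar>w i\<bar> powr \<alpha> * (p (Suc i) - p i))"
    using \<open>0 < r\<close>
    by (simp add: sum_distrib_left powr_divide powr_minus abs_divide divide_simps cong: sum.cong)
  have "(\<integral>\<^sup>+\<omega>. ennreal (trunc_sq (?S \<omega>)) \<partial>M)
      \<le> ennreal (8 * (\<Sum>i<N. \<bar>w i / r\<bar> powr \<alpha> * (p (Suc i) - p i)))"
  proof (rule nn_integral_trunc_sq_stable[OF _ _ _ alpha_pos])
    show "?S \<in> borel_measurable M"
      using * by (intro measurable_of_adapted[of _ "p N"]) auto
    show "0 \<le> (\<Sum>i<N. \<bar>w i / r\<bar> powr \<alpha> * (p (Suc i) - p i))"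
      using mono by (intro sum_nonneg) auto
  qed (use * in auto)
  moreover have "(\<Sum>i<N. w i * (Z (p (Suc i)) \<omega> - Z (p i) \<omega>)) / r = ?S \<omega>" for \<omega>
    by (simp add: sum_divide_distrib)
  ultimately show ?thesis
    unfolding eq by (simp only:)
qed

end

text \<open>Replacing Y by a nearby S costs \<open>2 * \<epsilon> / r\<close> by the Lipschitz bound
  where they are \<epsilon>-close, and at most 1 on the exceptional set, whose probability is at
  most \<epsilon>.\<close>

lemma (in prob_space) nn_integral_trunc_sq_limit:
  assumes [measurable]: "Y \<in> borel_measurable M" and "0 < r"
    and approx: "\<And>\<epsilon>. 0 < \<epsilon> \<Longrightarrow> \<exists>S. S \<in> borel_measurable M \<and>
      prob {\<omega>\<in>space M. \<epsilon> < \<bar>S \<omega> - Y \<omega>\<bar>} \<le> \<epsilon> \<and>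
      (\<integral>\<^sup>+\<omega>. ennreal (trunc_sq (S \<omega> / r)) \<partial>M) \<le> ennreal K"
  shows "(\<integral>\<^sup>+\<omega>. ennreal (trunc_sq (Y \<omega> / r)) \<partial>M) \<le> ennreal K"
proof (rule ennreal_le_epsilon)
  fix \<eta> :: real assume "0 < \<eta>"
  \<comment> \<open>Chosen so that the two error terms \<open>2 * \<epsilon> / r\<close> and
    \<open>\<epsilon>\<close> add up to exactly \<eta>.\<close>
  define \<epsilon> where "\<epsilon> = \<eta> / (1 + 2 / r)"
  have pos: "0 < 1 + 2 / r"
    using \<open>0 < r\<close> by (simp add: add_pos_pos)
  then have "\<epsilon> * (1 + 2 / r) = \<eta>"
    by (simp add: \<epsilon>_def)
  then have eps: "2 * \<epsilon> / r + \<epsilon> = \<eta>"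
    by (simp add: distrib_left add.commute mult.commute)
  have "0 < \<epsilon>"
    using pos \<open>0 < \<eta>\<close> by (simp add: \<epsilon>_def)
  obtain S where [measurable]: "S \<in> borel_measurable M"
    and prob: "prob {\<omega>\<in>space M. \<epsilon> < \<bar>S \<omega> - Y \<omega>\<bar>} \<le> \<epsilon>"
    and S: "(\<integral>\<^sup>+\<omega>. ennreal (trunc_sq (S \<omega> / r)) \<partial>M) \<le> ennreal K"
    using approx[OF \<open>0 < \<epsilon>\<close>] by blast
  let ?A = "{\<omega>\<in>space M. \<epsilon> < \<bar>S \<omega> - Y \<omega>\<bar>}"
  have "(\<integral>\<^sup>+\<omega>. ennreal (trunc_sq (Y \<omega> / r)) \<partial>M)
      \<le> (\<integral>\<^sup>+\<omega>. ennreal (trunc_sq (S \<omega> / r)) + (ennreal (2 * \<epsilon> / r) + indicator ?A \<omega>) \<partial>M)"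
  proof (rule nn_integral_mono)
    fix \<omega> assume "\<omega> \<in> space M"
    show "ennreal (trunc_sq (Y \<omega> / r))
        \<le> ennreal (trunc_sq (S \<omega> / r)) + (ennreal (2 * \<epsilon> / r) + indicator ?A \<omega>)"
    proof (cases "\<omega> \<in> ?A")
      case True
      have "ennreal (trunc_sq (Y \<omega> / r)) \<le> 1"
        using trunc_sq_le_1 by (simp add: ennreal_le_1)
      also have "\<dots> \<le> ennreal (trunc_sq (S \<omega> / r)) + (ennreal (2 * \<epsilon> / r) + 1)"
        by (simp add: add.assoc[symmetric])
      finally show ?thesis using True by simp
    next
      case False
      then have "\<bar>Y \<omega> - S \<omega>\<bar> \<le> \<epsilon>"
        using \<open>\<omega> \<in> space M\<close> by auto
      then have "\<bar>Y \<omega> / r - S \<omega> / r\<bar> \<le> \<epsilon> / r"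
        using \<open>0 < r\<close> by (simp add: diff_divide_distrib[symmetric] divide_right_mono)
      then have "trunc_sq (Y \<omega> / r) \<le> trunc_sq (S \<omega> / r) + 2 * \<epsilon> / r"
        using trunc_sq_lipschitz[of "Y \<omega> / r" "S \<omega> / r"] by simp
      then have "ennreal (trunc_sq (Y \<omega> / r)) \<le> ennreal (trunc_sq (S \<omega> / r) + 2 * \<epsilon> / r)"
        by (rule ennreal_leI)
      then show ?thesis
        using False \<open>0 < r\<close> \<open>0 < \<epsilon>\<close> by (simp add: ennreal_plus)
    qed
  qed
  also have "\<dots> = (\<integral>\<^sup>+\<omega>. ennreal (trunc_sq (S \<omega> / r)) \<partial>M) + (ennreal (2 * \<epsilon> / r) + emeasure M ?A)"
    by (simp add: nn_integral_add emeasure_space_1)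
  also have "\<dots> \<le> ennreal K + (ennreal (2 * \<epsilon> / r) + ennreal \<epsilon>)"
    using prob S by (intro add_mono) (auto simp: emeasure_eq_measure intro: ennreal_leI)
  also have "\<dots> = ennreal K + ennreal \<eta>"
    using eps \<open>0 < \<epsilon>\<close> \<open>0 < r\<close> by (simp flip: ennreal_plus)
  finally show "(\<integral>\<^sup>+\<omega>. ennreal (trunc_sq (Y \<omega> / r)) \<partial>M) \<le> ennreal K + ennreal \<eta>" .
qed

text \<open>Integrals over \<open>[0, s]\<close> and \<open>[0, t]\<close> can be subtracted at the
  level of Riemann sums only on a common partition, so t has to be one of the nodes.\<close>

lemma partition_through:
  fixes s t \<delta> :: real
  assumes "0 \<le> t" "t \<le> s" "0 < \<delta>"
  obtains p :: "nat \<Rightarrow> real" and m N where "p 0 = 0" "m \<le> N" "p m = t" "p N = s"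
    "\<And>i. p i \<le> p (Suc i)" "\<And>i. p (Suc i) - p i < \<delta>"
proof -
  obtain k :: nat where k: "s / \<delta> < real k"
    using reals_Archimedean2 by blast
  have "0 < k"
    using k assms by (intro gr0I) (auto simp: field_simps)
  then have small: "s / real k < \<delta>"
    using k assms by (simp add: field_simps)
  \<comment> \<open>k equal steps cover \<open>[0, t]\<close> and k more cover
    \<open>[t, s]\<close>, each of length at most \<open>s / real k\<close>. Past index
    \<open>2 * k\<close> the second formula keeps going in the same steps, so monotonicity and the
    mesh bound hold at every index.\<close>
  define p where "p i = (if i \<le> k then t * (real i / real k) else t + (s - t) * ((real i - real k) / real k))" for i
  have step: "p (Suc i) - p i = t / real k \<or> p (Suc i) - p i = (s - t) / real k" for i
  proof (cases "i = k")
    case True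
    then show ?thesis using \<open>0 < k\<close> by (simp add: p_def)
  next
    case False
    then show ?thesis using \<open>0 < k\<close> by (auto simp: p_def field_simps)
  qed
  show thesis
  proof (rule that[of p k "2 * k"])
    have le: "0 \<le> t / real k" "0 \<le> (s - t) / real k" "t / real k \<le> s / real k" "(s - t) / real k \<le> s / real k"
      using assms by (auto intro: divide_right_mono)
    show "p i \<le> p (Suc i)" "p (Suc i) - p i < \<delta>" for i
      using step[of i] small le by linarith+
  qed (use \<open>0 < k\<close> in \<open>auto simp: p_def\<close>)
qed

section \<open>Differences of two stochastic integrals\<close>

context stable_levy
begin

text \<open>On a partition through t the difference of the Riemann sums is again a weighted sum of
  increments, so the stable estimate applies to it and passes to the limit. K bounds the
  \<alpha>-power sums over all such partitions, so no convergence of these deterministic sums has to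
  be shown.\<close>

lemma nn_integral_stochastic_integral_diff:
  assumes I: "has_stochastic_integral M Z f 0 s I" and J: "has_stochastic_integral M Z g 0 t J"
    and "0 \<le> t" "t \<le> s" "0 < r"
    and K: "\<And>p m N. p 0 = 0 \<Longrightarrow> m \<le> N \<Longrightarrow> p m = t \<Longrightarrow> p N = s \<Longrightarrow> (\<And>i. p i \<le> p (Suc i)) \<Longrightarrow>
      (\<Sum>i\<in>{0..<m}. \<bar>f (p i) - g (p i)\<bar> powr \<alpha> * (p (Suc i) - p i)) +
      (\<Sum>i\<in>{m..<N}. \<bar>f (p i)\<bar> powr \<alpha> * (p (Suc i) - p i)) \<le> K"
  shows "(\<integral>\<^sup>+\<omega>. ennreal (trunc_sq ((I \<omega> - J \<omega>) / r)) \<partial>M) \<le> ennreal (8 * (r powr - \<alpha> * K))"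
proof (rule nn_integral_trunc_sq_limit[OF _ \<open>0 < r\<close>])
  have [measurable]: "I \<in> borel_measurable M" "J \<in> borel_measurable M"
    using I J by (auto simp: has_stochastic_integral_def)
  show "(\<lambda>\<omega>. I \<omega> - J \<omega>) \<in> borel_measurable M"
    by measurable
  fix \<epsilon> :: real assume "0 < \<epsilon>"
  then have "0 < \<epsilon> / 2" by simp
  let ?R = "\<lambda>f p N \<omega>. \<Sum>i<N. f (p i) * (Z (p (Suc i)) \<omega> - Z (p i) \<omega>)"
  obtain \<delta>1 where \<delta>1: "0 < \<delta>1" "\<And>N p. p 0 = 0 \<Longrightarrow> p N = s \<Longrightarrow>
      (\<And>i. i < N \<Longrightarrow> p i \<le> p (Suc i) \<and> p (Suc i) - p i < \<delta>1) \<Longrightarrow>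
      prob {\<omega>\<in>space M. \<epsilon> / 2 < \<bar>?R f p N \<omega> - I \<omega>\<bar>} < \<epsilon> / 2"
    using I \<open>0 < \<epsilon> / 2\<close> unfolding has_stochastic_integral_def by blast
  obtain \<delta>2 where \<delta>2: "0 < \<delta>2" "\<And>N p. p 0 = 0 \<Longrightarrow> p N = t \<Longrightarrow>
      (\<And>i. i < N \<Longrightarrow> p i \<le> p (Suc i) \<and> p (Suc i) - p i < \<delta>2) \<Longrightarrow>
      prob {\<omega>\<in>space M. \<epsilon> / 2 < \<bar>?R g p N \<omega> - J \<omega>\<bar>} < \<epsilon> / 2"
    using J \<open>0 < \<epsilon> / 2\<close> unfolding has_stochastic_integral_def by blast
  obtain p m N where p: "p 0 = 0" "m \<le> N" "p m = t" "p N = s"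
    and mono: "\<And>i. p i \<le> p (Suc i)" and mesh: "\<And>i. p (Suc i) - p i < min \<delta>1 \<delta>2"
    using partition_through[OF \<open>0 \<le> t\<close> \<open>t \<le> s\<close>, of "min \<delta>1 \<delta>2"] \<delta>1(1) \<delta>2(1) by auto
  have nonneg: "0 \<le> p i" for i
    using lift_Suc_mono_le[of p 0 i] mono p(1) by simp
  have [measurable]: "Z (p i) \<in> borel_measurable M" for i
    by (intro measurable_Z nonneg)
  \<comment> \<open>The integrand g is continued by 0 after t: the weights are \<open>f - g\<close>
    before node m and f from there on.\<close>
  define w where "w i = (if i < m then f (p i) - g (p i) else f (p i))" for i
  let ?S = "\<lambda>\<omega>. \<Sum>i<N. w i * (Z (p (Suc i)) \<omega> - Z (p i) \<omega>)"
  have split: "sum h {..<N} = sum h {0..<m} + sum h {m..<N}" for h :: "nat \<Rightarrow> real"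
    using p(2) by (simp add: sum.atLeastLessThan_concat lessThan_atLeast0)
  have S: "?S \<omega> = ?R f p N \<omega> - ?R g p m \<omega>" for \<omega>
  proof -
    have "(\<Sum>i\<in>{0..<m}. w i * (Z (p (Suc i)) \<omega> - Z (p i) \<omega>))
        = (\<Sum>i\<in>{0..<m}. f (p i) * (Z (p (Suc i)) \<omega> - Z (p i) \<omega>)) - ?R g p m \<omega>"
      by (simp add: w_def left_diff_distrib sum_subtractf lessThan_atLeast0)
    moreover have "(\<Sum>i\<in>{m..<N}. w i * (Z (p (Suc i)) \<omega> - Z (p i) \<omega>))
        = (\<Sum>i\<in>{m..<N}. f (p i) * (Z (p (Suc i)) \<omega> - Z (p i) \<omega>))"
      by (simp add: w_def)
    ultimately show ?thesis
      by (simp add: split)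
  qed
  have "\<epsilon> / 2 < \<bar>a - i\<bar> \<or> \<epsilon> / 2 < \<bar>b - j\<bar>" if "\<epsilon> < \<bar>(a - b) - (i - j)\<bar>" for a b i j
    using that by linarith
  then have "{\<omega>\<in>space M. \<epsilon> < \<bar>?S \<omega> - (I \<omega> - J \<omega>)\<bar>}
      \<subseteq> {\<omega>\<in>space M. \<epsilon> / 2 < \<bar>?R f p N \<omega> - I \<omega>\<bar>} \<union> {\<omega>\<in>space M. \<epsilon> / 2 < \<bar>?R g p m \<omega> - J \<omega>\<bar>}"
    unfolding S by blast
  then have "prob {\<omega>\<in>space M. \<epsilon> < \<bar>?S \<omega> - (I \<omega> - J \<omega>)\<bar>}
      \<le> prob ({\<omega>\<in>space M. \<epsilon> / 2 < \<bar>?R f p N \<omega> - I \<omega>\<bar>} \<union> {\<omega>\<in>space M. \<epsilon> / 2 < \<bar>?R g p m \<omega> - J \<omega>\<bar>})"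
    by (intro finite_measure_mono) measurable
  also have "\<dots> \<le> prob {\<omega>\<in>space M. \<epsilon> / 2 < \<bar>?R f p N \<omega> - I \<omega>\<bar>}
      + prob {\<omega>\<in>space M. \<epsilon> / 2 < \<bar>?R g p m \<omega> - J \<omega>\<bar>}"
    by (intro measure_Un_le) measurable
  also have "\<dots> \<le> \<epsilon> / 2 + \<epsilon> / 2"
    using \<delta>1(2)[of p N] \<delta>2(2)[of p m] p mono mesh by (intro add_mono less_imp_le) auto
  finally have prob: "prob {\<omega>\<in>space M. \<epsilon> < \<bar>?S \<omega> - (I \<omega> - J \<omega>)\<bar>} \<le> \<epsilon>"
    by simp
  have "(\<Sum>i<N. \<bar>w i\<bar> powr \<alpha> * (p (Suc i) - p i)) \<le> K"
    unfolding split using K[OF p mono] by (simp add: w_def)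
  then have "ennreal (8 * (r powr - \<alpha> * (\<Sum>i<N. \<bar>w i\<bar> powr \<alpha> * (p (Suc i) - p i))))
      \<le> ennreal (8 * (r powr - \<alpha> * K))"
    by (intro ennreal_leI mult_left_mono) auto
  then have "(\<integral>\<^sup>+\<omega>. ennreal (trunc_sq (?S \<omega> / r)) \<partial>M) \<le> ennreal (8 * (r powr - \<alpha> * K))"
    using nn_integral_weighted_increments[of p N r w] nonneg mono \<open>0 < r\<close>
    by (auto intro: order_trans)
  moreover have "?S \<in> borel_measurable M"
    by measurable
  ultimately show "\<exists>S. S \<in> borel_measurable M \<and>
      prob {\<omega>\<in>space M. \<epsilon> < \<bar>S \<omega> - (I \<omega> - J \<omega>)\<bar>} \<le> \<epsilon> \<and>
      (\<integral>\<^sup>+\<omega>. ennreal (trunc_sq (S \<omega> / r)) \<partial>M) \<le> ennreal (8 * (r powr - \<alpha> * K))"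
    using prob by blast
qed

end

text \<open>Left-point sums of an increasing function stay below its integral. Term by term this is
  \<open>c * d \<le> exp (c * d) - 1\<close> for a step of length d, and the resulting bounds
  telescope.\<close>

lemma riemann_sum_exp_le:
  fixes c :: real
  assumes "0 < c" "m \<le> N" "\<And>i. p i \<le> p (Suc i)"
  shows "(\<Sum>i\<in>{m..<N}. exp (- c * (t - p i)) * (p (Suc i) - p i))
    \<le> (exp (- c * (t - p N)) - exp (- c * (t - p m))) / c"
proof -
  have "(\<Sum>i\<in>{m..<N}. exp (- c * (t - p i)) * (p (Suc i) - p i))
      \<le> (\<Sum>i\<in>{m..<N}. exp (- c * (t - p (Suc i))) / c - exp (- c * (t - p i)) / c)"
  proof (rule sum_mono)
    fix i
    let ?d = "p (Suc i) - p i"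
    have "c * ?d \<le> exp (c * ?d) - 1"
      using exp_ge_add_one_self[of "c * ?d"] by linarith
    then have "exp (- c * (t - p i)) * (c * ?d) \<le> exp (- c * (t - p i)) * (exp (c * ?d) - 1)"
      by (intro mult_left_mono) auto
    also have "\<dots> = exp (- c * (t - p (Suc i))) - exp (- c * (t - p i))"
      by (simp add: right_diff_distrib exp_add[symmetric] algebra_simps)
    finally show "exp (- c * (t - p i)) * ?d \<le> exp (- c * (t - p (Suc i))) / c - exp (- c * (t - p i)) / c"
      using \<open>0 < c\<close> by (simp add: field_simps)
  qed
  also have "\<dots> = (exp (- c * (t - p N)) - exp (- c * (t - p m))) / c"
    using sum_Suc_diff'[OF \<open>m \<le> N\<close>, of "\<lambda>i. exp (- c * (t - p i)) / c"]
    by (simp add: diff_divide_distrib)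
  finally show ?thesis .
qed

section \<open>Estimates for the Ornstein-Uhlenbeck kernel\<close>

context stable_levy
begin

lemma ou_powr:
  assumes "0 < \<beta>"
  shows "\<bar>exp (- \<gamma> * u) * \<beta>\<bar> powr \<alpha> = \<beta> powr \<alpha> * exp (- (\<alpha> * \<gamma>) * u)"
  using assms by (simp add: abs_mult powr_mult exp_powr_real mult_ac)

text \<open>The \<alpha>-th power of the kernel is again exponential, with rate
  \<open>\<alpha> * \<gamma>\<close>. Its integral over \<open>[0, t]\<close> is below
  \<open>\<beta> powr \<alpha> / (\<alpha> * \<gamma>)\<close>, uniformly in t.\<close>

lemma nn_integral_ou_integral:
  assumes "has_stochastic_integral M Z (\<lambda>u. exp (- \<gamma> * (t - u)) * \<beta>) 0 t I"
    and "0 \<le> t" "0 < r" "0 < \<beta>" "0 < \<gamma>"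
  shows "(\<integral>\<^sup>+\<omega>. ennreal (trunc_sq (I \<omega> / r)) \<partial>M)
    \<le> ennreal (8 * (r powr - \<alpha> * (\<beta> powr \<alpha> / (\<alpha> * \<gamma>))))"
proof -
  \<comment> \<open>Comparison with the zero integral over the same interval turns the difference
    estimate into one for I alone. All its Riemann sums vanish, so any mesh bound serves, here
    1.\<close>
  have zero: "has_stochastic_integral M Z (\<lambda>_. 0) 0 t (\<lambda>_. 0)"
    by (auto simp: has_stochastic_integral_def intro: exI[of _ 1])
  have "(\<integral>\<^sup>+\<omega>. ennreal (trunc_sq ((I \<omega> - 0) / r)) \<partial>M)
    \<le> ennreal (8 * (r powr - \<alpha> * (\<beta> powr \<alpha> / (\<alpha> * \<gamma>))))"
  proof (rule nn_integral_stochastic_integral_diff[OF assms(1) zero assms(2) order_refl assms(3)])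
    fix p :: "nat \<Rightarrow> real" and m N
    assume p: "p 0 = 0" "m \<le> N" "p m = t" "p N = t" and mono: "\<And>i. p i \<le> p (Suc i)"
    have "(\<Sum>i\<in>{0..<m}. \<bar>exp (- \<gamma> * (t - p i)) * \<beta> - 0\<bar> powr \<alpha> * (p (Suc i) - p i)) +
        (\<Sum>i\<in>{m..<N}. \<bar>exp (- \<gamma> * (t - p i)) * \<beta>\<bar> powr \<alpha> * (p (Suc i) - p i))
        = (\<Sum>i\<in>{0..<N}. \<bar>exp (- \<gamma> * (t - p i)) * \<beta>\<bar> powr \<alpha> * (p (Suc i) - p i))"
      using p by (simp add: sum.atLeastLessThan_concat)
    also have "\<dots> = \<beta> powr \<alpha> * (\<Sum>i\<in>{0..<N}. exp (- (\<alpha> * \<gamma>) * (t - p i)) * (p (Suc i) - p i))"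
      unfolding ou_powr[OF \<open>0 < \<beta>\<close>] by (simp add: sum_distrib_left mult.assoc)
    also have "\<dots> \<le> \<beta> powr \<alpha> * ((exp (- (\<alpha> * \<gamma>) * (t - p N)) - exp (- (\<alpha> * \<gamma>) * (t - p 0))) / (\<alpha> * \<gamma>))"
      using alpha_pos assms(5) mono by (intro mult_left_mono riemann_sum_exp_le) auto
    also have "\<dots> \<le> \<beta> powr \<alpha> * (1 / (\<alpha> * \<gamma>))"
      using alpha_pos assms p by (intro mult_left_mono divide_right_mono) auto
    finally show "(\<Sum>i\<in>{0..<m}. \<bar>exp (- \<gamma> * (t - p i)) * \<beta> - 0\<bar> powr \<alpha> * (p (Suc i) - p i)) +
        (\<Sum>i\<in>{m..<N}. \<bar>exp (- \<gamma> * (t - p i)) * \<beta>\<bar> powr \<alpha> * (p (Suc i) - p i)) \<le> \<beta> powr \<alpha> / (\<alpha> * \<gamma>)"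
      by simp
  qed
  then show ?thesis by simp
qed

text \<open>Two sources of change: on \<open>[0, t]\<close> the old noise is damped further, giving
  the first summand in the bracket; on \<open>[t, s]\<close> new noise enters, giving the
  second.\<close>

lemma nn_integral_ou_increment:
  assumes I: "has_stochastic_integral M Z (\<lambda>u. exp (- \<gamma> * (s - u)) * \<beta>) 0 s I"
    and J: "has_stochastic_integral M Z (\<lambda>u. exp (- \<gamma> * (t - u)) * \<beta>) 0 t J"
    and "0 \<le> t" "t \<le> s" "0 < r" "0 < \<beta>" "0 < \<gamma>"
  shows "(\<integral>\<^sup>+\<omega>. ennreal (trunc_sq ((I \<omega> - J \<omega>) / r)) \<partial>M)
    \<le> ennreal (8 * (r powr - \<alpha> * (\<beta> powr \<alpha> / (\<alpha> * \<gamma>) *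
        ((1 - exp (- \<gamma> * (s - t))) powr \<alpha> + (1 - exp (- (\<alpha> * \<gamma>) * (s - t)))))))"
proof (rule nn_integral_stochastic_integral_diff[OF I J assms(3-5)])
  fix p :: "nat \<Rightarrow> real" and m N
  assume p: "p 0 = 0" "m \<le> N" "p m = t" "p N = s" and mono: "\<And>i. p i \<le> p (Suc i)"
  let ?c = "\<alpha> * \<gamma>" and ?q = "(1 - exp (- \<gamma> * (s - t))) powr \<alpha>"
  have c: "0 < ?c" using alpha_pos assms by simp
  \<comment> \<open>By the semigroup property of the exponential, the kernels for s and t differ by
    the constant factor \<open>1 - exp (- \<gamma> * (s - t))\<close>, which leaves the sum as a
    multiple of the kernel sum for t.\<close>
  have "\<bar>exp (- \<gamma> * (s - u)) * \<beta> - exp (- \<gamma> * (t - u)) * \<beta>\<bar> powr \<alpha> = ?q * (\<beta> powr \<alpha> * exp (- ?c * (t - u)))" for u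
  proof -
    have "exp (- \<gamma> * (s - u)) = exp (- \<gamma> * (s - t)) * exp (- \<gamma> * (t - u))"
      by (simp add: exp_add[symmetric] algebra_simps)
    then have "exp (- \<gamma> * (s - u)) * \<beta> - exp (- \<gamma> * (t - u)) * \<beta>
        = - ((1 - exp (- \<gamma> * (s - t))) * (exp (- \<gamma> * (t - u)) * \<beta>))"
      by (simp add: algebra_simps)
    moreover have "0 \<le> 1 - exp (- \<gamma> * (s - t))"
      using assms by simp
    ultimately show ?thesis
      unfolding ou_powr[OF \<open>0 < \<beta>\<close>, symmetric] by (simp only: abs_minus abs_mult powr_mult abs_of_nonneg)
  qed
  then have "(\<Sum>i\<in>{0..<m}. \<bar>exp (- \<gamma> * (s - p i)) * \<beta> - exp (- \<gamma> * (t - p i)) * \<beta>\<bar> powr \<alpha> * (p (Suc i) - p i))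
      = ?q * \<beta> powr \<alpha> * (\<Sum>i\<in>{0..<m}. exp (- ?c * (t - p i)) * (p (Suc i) - p i))"
    by (simp add: sum_distrib_left mult.assoc)
  also have "\<dots> \<le> ?q * \<beta> powr \<alpha> * ((exp (- ?c * (t - p m)) - exp (- ?c * (t - p 0))) / ?c)"
    using c mono by (intro mult_left_mono riemann_sum_exp_le) auto
  also have "\<dots> \<le> ?q * \<beta> powr \<alpha> * (1 / ?c)"
    using c p by (intro mult_left_mono divide_right_mono) auto
  finally have 1: "(\<Sum>i\<in>{0..<m}. \<bar>exp (- \<gamma> * (s - p i)) * \<beta> - exp (- \<gamma> * (t - p i)) * \<beta>\<bar> powr \<alpha> * (p (Suc i) - p i))
      \<le> ?q * \<beta> powr \<alpha> * (1 / ?c)" .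
  have "(\<Sum>i\<in>{m..<N}. \<bar>exp (- \<gamma> * (s - p i)) * \<beta>\<bar> powr \<alpha> * (p (Suc i) - p i))
      = \<beta> powr \<alpha> * (\<Sum>i\<in>{m..<N}. exp (- ?c * (s - p i)) * (p (Suc i) - p i))"
    unfolding ou_powr[OF \<open>0 < \<beta>\<close>] by (simp add: sum_distrib_left mult.assoc)
  also have "\<dots> \<le> \<beta> powr \<alpha> * ((exp (- ?c * (s - p N)) - exp (- ?c * (s - p m))) / ?c)"
    using c mono p by (intro mult_left_mono riemann_sum_exp_le) auto
  finally have 2: "(\<Sum>i\<in>{m..<N}. \<bar>exp (- \<gamma> * (s - p i)) * \<beta>\<bar> powr \<alpha> * (p (Suc i) - p i))
      \<le> \<beta> powr \<alpha> * ((1 - exp (- ?c * (s - t))) / ?c)"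
    using p by simp
  have "?q * \<beta> powr \<alpha> * (1 / ?c) + \<beta> powr \<alpha> * ((1 - exp (- ?c * (s - t))) / ?c)
      = \<beta> powr \<alpha> / ?c * (?q + (1 - exp (- ?c * (s - t))))"
    by (simp add: distrib_left)
  with 1 2 show "(\<Sum>i\<in>{0..<m}. \<bar>exp (- \<gamma> * (s - p i)) * \<beta> - exp (- \<gamma> * (t - p i)) * \<beta>\<bar> powr \<alpha> * (p (Suc i) - p i)) +
      (\<Sum>i\<in>{m..<N}. \<bar>exp (- \<gamma> * (s - p i)) * \<beta>\<bar> powr \<alpha> * (p (Suc i) - p i))
      \<le> \<beta> powr \<alpha> / ?c * (?q + (1 - exp (- ?c * (s - t))))"
    by linarith
qed

end

section \<open>Tails of sums of squares\<close>

text \<open>Either some term is truncated and alone contributes 1, or none is, and the sum is the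
  sum of squares divided by \<open>r\<^sup>2\<close>. Extended nonnegative sums include the
  divergent case.\<close>

lemma one_le_suminf_trunc_sq:
  fixes y :: "nat \<Rightarrow> real"
  assumes "0 < r" "ennreal (r\<^sup>2) < (\<Sum>n. ennreal ((y n)\<^sup>2))"
  shows "1 \<le> (\<Sum>n. ennreal (trunc_sq (y n / r)))"
proof (cases "\<exists>n. 1 \<le> (y n / r)\<^sup>2")
  case True
  then obtain n where "trunc_sq (y n / r) = 1"
    unfolding trunc_sq_def by (metis min.absorb1)
  then have "1 = (\<Sum>i\<in>{n}. ennreal (trunc_sq (y i / r)))"
    by simp
  also have "\<dots> \<le> (\<Sum>n. ennreal (trunc_sq (y n / r)))"
    by (intro sum_le_suminf) auto
  finally show ?thesis .
next
  case False
  then have "trunc_sq (y n / r) = (y n)\<^sup>2 / r\<^sup>2" for n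
    unfolding trunc_sq_def by (metis min.absorb2 nle_le power_divide)
  then have "(\<Sum>n. ennreal (trunc_sq (y n / r))) = (\<Sum>n. ennreal (1 / r\<^sup>2) * ennreal ((y n)\<^sup>2))"
    by (simp flip: ennreal_mult)
  also have "\<dots> = ennreal (1 / r\<^sup>2) * (\<Sum>n. ennreal ((y n)\<^sup>2))"
    by simp
  also have "\<dots> \<ge> ennreal (1 / r\<^sup>2) * ennreal (r\<^sup>2)"
    using assms by (intro mult_left_mono) auto
  also have "ennreal (1 / r\<^sup>2) * ennreal (r\<^sup>2) = 1"
    using assms by (simp flip: ennreal_mult)
  finally show ?thesis .
qed

text \<open>Markov's inequality: the indicator of the event lies below the sum of truncated squares,
  which is integrated termwise.\<close>

lemma (in prob_space) emeasure_sum_squares_gt: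
  fixes Y :: "nat \<Rightarrow> 'a \<Rightarrow> real"
  assumes [measurable]: "\<And>n. Y n \<in> borel_measurable M"
    and "0 < r" "summable b"
    and b: "\<And>n. (\<integral>\<^sup>+\<omega>. ennreal (trunc_sq (Y n \<omega> / r)) \<partial>M) \<le> ennreal (b n)" "\<And>n. 0 \<le> b n"
  shows "emeasure M {\<omega>\<in>space M. ennreal (r\<^sup>2) < (\<Sum>n. ennreal ((Y n \<omega>)\<^sup>2))} \<le> ennreal (suminf b)"
proof -
  let ?A = "{\<omega>\<in>space M. ennreal (r\<^sup>2) < (\<Sum>n. ennreal ((Y n \<omega>)\<^sup>2))}"
  have "emeasure M ?A = (\<integral>\<^sup>+\<omega>. indicator ?A \<omega> \<partial>M)"
    by simp
  also have "\<dots> \<le> (\<integral>\<^sup>+\<omega>. (\<Sum>n. ennreal (trunc_sq (Y n \<omega> / r))) \<partial>M)"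
    using one_le_suminf_trunc_sq[OF \<open>0 < r\<close>]
    by (intro nn_integral_mono) (auto split: split_indicator)
  also have "\<dots> = (\<Sum>n. \<integral>\<^sup>+\<omega>. ennreal (trunc_sq (Y n \<omega> / r)) \<partial>M)"
    by (rule nn_integral_suminf) measurable
  also have "\<dots> \<le> (\<Sum>n. ennreal (b n))"
    using b by (intro suminf_le) auto
  also have "\<dots> = ennreal (suminf b)"
    using b \<open>summable b\<close> by (intro suminf_ennreal2) auto
  finally show ?thesis .
qed

text \<open>A discrete layer-cake bound: the positive part of Y is at most its ceiling, which counts
  the naturals m with \<open>real m < Y \<omega>\<close>.\<close>

lemma nn_integral_le_sum_tail:
  assumes [measurable]: "Y \<in> borel_measurable M"
  shows "(\<integral>\<^sup>+\<omega>. ennreal (Y \<omega>) \<partial>M) \<le> (\<Sum>m. emeasure M {\<omega>\<in>space M. real m < Y \<omega>})"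
proof -
  have "(\<integral>\<^sup>+\<omega>. ennreal (Y \<omega>) \<partial>M)
      \<le> (\<integral>\<^sup>+\<omega>. (\<Sum>m. indicator {\<omega>\<in>space M. real m < Y \<omega>} \<omega>) \<partial>M)"
  proof (rule nn_integral_mono)
    fix \<omega> assume "\<omega> \<in> space M"
    have "ennreal (Y \<omega>) \<le> ennreal (real (nat \<lceil>Y \<omega>\<rceil>))"
      by (intro ennreal_leI real_nat_ceiling_ge)
    also have "\<dots> = (\<Sum>m<nat \<lceil>Y \<omega>\<rceil>. 1)"
      by (simp add: ennreal_of_nat_eq_real_of_nat)
    also have "\<dots> \<le> (\<Sum>m<nat \<lceil>Y \<omega>\<rceil>. indicator {\<omega>\<in>space M. real m < Y \<omega>} \<omega>)"
      using \<open>\<omega> \<in> space M\<close>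
      by (intro sum_mono) (auto simp: zless_nat_eq_int_zless less_ceiling_iff split: split_indicator)
    also have "\<dots> \<le> (\<Sum>m. indicator {\<omega>\<in>space M. real m < Y \<omega>} \<omega>)"
      by (intro sum_le_suminf) auto
    finally show "ennreal (Y \<omega>) \<le> (\<Sum>m. indicator {\<omega>\<in>space M. real m < Y \<omega>} \<omega>)" .
  qed
  also have "\<dots> = (\<Sum>m. \<integral>\<^sup>+\<omega>. indicator {\<omega>\<in>space M. real m < Y \<omega>} \<omega> \<partial>M)"
    by (rule nn_integral_suminf) measurable
  also have "\<dots> = (\<Sum>m. emeasure M {\<omega>\<in>space M. real m < Y \<omega>})"
    by simp
  finally show ?thesis .
qed

text \<open>The p-th power exceeds m exactly when Y exceeds \<open>real m powr (1 / p)\<close>,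
  which has probability of order \<open>real m powr (- \<alpha> / p)\<close>. This is summable
  because \<open>p < \<alpha>\<close>; the level 0 is bounded by the total mass 1.\<close>

lemma (in prob_space) nn_integral_powr_le_of_tail:
  assumes [measurable]: "Y \<in> borel_measurable M" and "\<And>\<omega>. 0 \<le> Y \<omega>"
    and p: "0 < p" "p < \<alpha>" and "0 \<le> C"
    and tail: "\<And>r. 0 < r \<Longrightarrow> emeasure M {\<omega>\<in>space M. r < Y \<omega>} \<le> ennreal (C * r powr - \<alpha>)"
  shows "(\<integral>\<^sup>+\<omega>. ennreal (Y \<omega> powr p) \<partial>M)
    \<le> ennreal (\<Sum>m. if m = 0 then 1 else C * real m powr (- \<alpha> / p))"
proof -
  let ?b = "\<lambda>m. if m = 0 then 1 else C * real m powr (- \<alpha> / p)"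
  have "(\<integral>\<^sup>+\<omega>. ennreal (Y \<omega> powr p) \<partial>M) \<le> (\<Sum>m. emeasure M {\<omega>\<in>space M. real m < Y \<omega> powr p})"
    by (rule nn_integral_le_sum_tail) measurable
  also have "\<dots> \<le> (\<Sum>m. ennreal (?b m))"
  proof (rule suminf_le)
    fix m :: nat
    show "emeasure M {\<omega>\<in>space M. real m < Y \<omega> powr p} \<le> ennreal (?b m)"
    proof (cases "m = 0")
      case True
      then show ?thesis using emeasure_le_1 by simp
    next
      case False
      have "{\<omega>\<in>space M. real m < Y \<omega> powr p} \<subseteq> {\<omega>\<in>space M. real m powr (1 / p) < Y \<omega>}"
      proof safe
        fix \<omega> assume "real m < Y \<omega> powr p"
        then have "real m powr (1 / p) < (Y \<omega> powr p) powr (1 / p)"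
          using p by (intro powr_less_mono2) auto
        also have "\<dots> = Y \<omega>"
          using p \<open>0 \<le> Y \<omega>\<close> by (simp add: powr_powr)
        finally show "real m powr (1 / p) < Y \<omega>" .
      qed
      then have "emeasure M {\<omega>\<in>space M. real m < Y \<omega> powr p}
          \<le> emeasure M {\<omega>\<in>space M. real m powr (1 / p) < Y \<omega>}"
        by (intro emeasure_mono) measurable
      also have "\<dots> \<le> ennreal (C * (real m powr (1 / p)) powr - \<alpha>)"
        using False by (intro tail) simp
      finally show ?thesis
        using False by (simp add: powr_powr)
    qed
  qed auto
  also have "\<dots> = ennreal (suminf ?b)"
  proof (rule suminf_ennreal2)
    have "summable (\<lambda>m. C * real m powr (- \<alpha> / p))"
      using p by (intro summable_mult) (simp add: summable_real_powr_iff field_simps)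
    then show "summable ?b"
      by (subst summable_cong[where g = "\<lambda>m. C * real m powr (- \<alpha> / p)"])
        (auto simp: eventually_sequentially intro!: exI[of _ 1])
  qed (use \<open>0 \<le> C\<close> in auto)
  finally show ?thesis .
qed

section \<open>Orthonormal series\<close>

lemma norm_sum_orthonormal:
  fixes e :: "nat \<Rightarrow> 'h::real_inner"
  assumes "\<And>m n. e m \<bullet> e n = (if m = n then 1 else 0)" "finite S"
  shows "(norm (\<Sum>i\<in>S. y i *\<^sub>R e i))\<^sup>2 = (\<Sum>i\<in>S. (y i)\<^sup>2)"
proof -
  have "(\<Sum>j\<in>S. y j * (if j = i then 1 else 0)) = (\<Sum>j\<in>S. if j = i then y j else 0)" for i
    by (intro sum.cong) auto
  then show ?thesis
    using assms(2)
    by (simp add: power2_norm_eq_inner inner_sum_left inner_sum_right assms(1))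
      (simp add: power2_eq_square)
qed

lemma bessel_inequality:
  fixes e :: "nat \<Rightarrow> 'h::real_inner"
  assumes e: "\<And>m n. e m \<bullet> e n = (if m = n then 1 else 0)"
  shows "summable (\<lambda>n. (x \<bullet> e n)\<^sup>2)" "(\<Sum>n. (x \<bullet> e n)\<^sup>2) \<le> (norm x)\<^sup>2"
proof -
  have le: "(\<Sum>n<N. (x \<bullet> e n)\<^sup>2) \<le> (norm x)\<^sup>2" for N
  proof -
    let ?s = "\<Sum>n<N. (x \<bullet> e n) *\<^sub>R e n"
    have "?s \<bullet> ?s = (\<Sum>n<N. (x \<bullet> e n)\<^sup>2)"
      using norm_sum_orthonormal[OF e, of "{..<N}" "\<lambda>n. x \<bullet> e n"] by (simp add: power2_norm_eq_inner)
    moreover have "x \<bullet> ?s = (\<Sum>n<N. (x \<bullet> e n)\<^sup>2)"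
      by (simp add: inner_sum_right power2_eq_square)
    moreover have "0 \<le> (x - ?s) \<bullet> (x - ?s)"
      by simp
    ultimately show ?thesis
      by (simp add: inner_diff_left inner_diff_right inner_commute power2_norm_eq_inner)
  qed
  then show "summable (\<lambda>n. (x \<bullet> e n)\<^sup>2)"
    by (intro summableI_nonneg_bounded) auto
  then show "(\<Sum>n. (x \<bullet> e n)\<^sup>2) \<le> (norm x)\<^sup>2"
    using le by (intro suminf_le_const) auto
qed

text \<open>By Pythagoras the blocks of the vector series have the same squared norms as the blocks
  of the series of squares; completeness and continuity of the norm do the rest.\<close>

lemma orthonormal_series:
  fixes e :: "nat \<Rightarrow> 'h::{real_inner, complete_space}"
  assumes e: "\<And>m n. e m \<bullet> e n = (if m = n then 1 else 0)"
    and "summable (\<lambda>n. (y n)\<^sup>2)"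
  shows "summable (\<lambda>n. y n *\<^sub>R e n)" "(norm (\<Sum>n. y n *\<^sub>R e n))\<^sup>2 = (\<Sum>n. (y n)\<^sup>2)"
proof -
  have "Cauchy (\<lambda>N. \<Sum>n<N. y n *\<^sub>R e n)"
  proof (rule CauchyI)
    fix \<epsilon> :: real assume "0 < \<epsilon>"
    then obtain N where N: "\<And>m n. N \<le> m \<Longrightarrow> norm (\<Sum>i = m..<n. (y i)\<^sup>2) < \<epsilon>\<^sup>2"
      
      using summable_Cauchy[THEN iffD1, OF assms(2), rule_format, of "\<epsilon>\<^sup>2"] by (meson zero_less_power)
    have *: "norm ((\<Sum>i<n. y i *\<^sub>R e i) - (\<Sum>i<m. y i *\<^sub>R e i)) < \<epsilon>" if "N \<le> m" "m \<le> n" for m n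
    proof -
      have "(\<Sum>i<n. y i *\<^sub>R e i) - (\<Sum>i<m. y i *\<^sub>R e i) = (\<Sum>i = m..<n. y i *\<^sub>R e i)"
        using that sum_diff_nat_ivl[of 0 m n "\<lambda>i. y i *\<^sub>R e i"] unfolding lessThan_atLeast0 by blast
      moreover have "(norm (\<Sum>i = m..<n. y i *\<^sub>R e i))\<^sup>2 < \<epsilon>\<^sup>2"
        unfolding norm_sum_orthonormal[OF e finite_atLeastLessThan]
        using abs_le_D1[OF order_refl] N[OF that(1), of n] unfolding real_norm_def
        by (rule order.strict_trans1)
      ultimately show ?thesis
        using \<open>0 < \<epsilon>\<close> by (metis less_imp_le power2_less_imp_less)
    qed
    show "\<exists>N. \<forall>m\<ge>N. \<forall>n\<ge>N. norm ((\<Sum>i<m. y i *\<^sub>R e i) - (\<Sum>i<n. y i *\<^sub>R e i)) < \<epsilon>"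
    proof (intro exI allI impI)
      fix m n assume "N \<le> m" "N \<le> n"
      then show "norm ((\<Sum>i<m. y i *\<^sub>R e i) - (\<Sum>i<n. y i *\<^sub>R e i)) < \<epsilon>"
        using *[of m n] *[of n m] by (metis nle_le norm_minus_commute)
    qed
  qed
  then have "convergent (\<lambda>N. \<Sum>n<N. y n *\<^sub>R e n)"
    by (rule Cauchy_convergent)
  then show sm: "summable (\<lambda>n. y n *\<^sub>R e n)"
    by (rule summable_iff_convergent[THEN iffD2])
  have "(\<lambda>N. (norm (\<Sum>n<N. y n *\<^sub>R e n))\<^sup>2) \<longlonglongrightarrow> (norm (\<Sum>n. y n *\<^sub>R e n))\<^sup>2"
    by (rule tendsto_power[OF tendsto_norm[OF summable_LIMSEQ[OF sm]]])
  then have "(\<lambda>N. \<Sum>n<N. (y n)\<^sup>2) \<longlonglongrightarrow> (norm (\<Sum>n. y n *\<^sub>R e n))\<^sup>2"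
    unfolding norm_sum_orthonormal[OF e finite_lessThan] .
  with summable_LIMSEQ[OF assms(2)] show "(norm (\<Sum>n. y n *\<^sub>R e n))\<^sup>2 = (\<Sum>n. (y n)\<^sup>2)"
    by (rule LIMSEQ_unique[symmetric])
qed

text \<open>Outside a tail event one knows only an inequality between extended reals; this extracts
  both convergence and the numerical bound from it.\<close>

lemma summable_sum_squares_iff:
  fixes y :: "nat \<Rightarrow> real"
  shows "(\<Sum>n. ennreal ((y n)\<^sup>2)) \<le> ennreal (r\<^sup>2) \<longleftrightarrow> summable (\<lambda>n. (y n)\<^sup>2) \<and> (\<Sum>n. (y n)\<^sup>2) \<le> r\<^sup>2"
proof
  assume le: "(\<Sum>n. ennreal ((y n)\<^sup>2)) \<le> ennreal (r\<^sup>2)"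
  then have "(\<Sum>n. ennreal ((y n)\<^sup>2)) \<noteq> \<top>"
    by (rule neq_top_trans[OF ennreal_neq_top])
  then have sm: "summable (\<lambda>n. (y n)\<^sup>2)"
    by (intro summable_suminf_not_top) auto
  have "(\<Sum>n. ennreal ((y n)\<^sup>2)) = ennreal (\<Sum>n. (y n)\<^sup>2)"
    by (rule suminf_ennreal2[OF _ sm]) simp
  with le sm show "summable (\<lambda>n. (y n)\<^sup>2) \<and> (\<Sum>n. (y n)\<^sup>2) \<le> r\<^sup>2"
    by (simp add: ennreal_le_iff)
next
  assume sm: "summable (\<lambda>n. (y n)\<^sup>2) \<and> (\<Sum>n. (y n)\<^sup>2) \<le> r\<^sup>2"
  then have "(\<Sum>n. ennreal ((y n)\<^sup>2)) = ennreal (\<Sum>n. (y n)\<^sup>2)"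
    by (intro suminf_ennreal2) auto
  with sm show "(\<Sum>n. ennreal ((y n)\<^sup>2)) \<le> ennreal (r\<^sup>2)"
    by (simp add: ennreal_le_iff)
qed

text \<open>Tannery's theorem for a general filter, needed because time tends to t within the
  half-line rather than along a sequence.\<close>

lemma tendsto_suminf_dominated:
  fixes a :: "nat \<Rightarrow> 'b \<Rightarrow> real"
  assumes "\<And>k. (a k \<longlongrightarrow> 0) F" "\<forall>\<^sub>F s in F. \<forall>k. norm (a k s) \<le> b k" "summable b"
  shows "((\<lambda>s. \<Sum>k. a k s) \<longlongrightarrow> 0) F"
proof (cases "F = bot")
  case False
  have "eventually (\<lambda>(k, s). norm (a k s) \<le> b k) (at_top \<times>\<^sub>F F)"
    unfolding eventually_prod_filter using assms(2) by (intro exI[of _ "\<lambda>_. True"] exI conjI) auto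
  from tannerys_theorem[OF assms(1) this assms(3) False] show ?thesis
    by simp
qed simp

text \<open>Triangle inequality between the deterministic part c and the random part d. The
  hypothesis on d has the form of the complement of a tail event and itself yields
  convergence.\<close>

lemma orthonormal_series_norm_le:
  fixes e :: "nat \<Rightarrow> 'h::{real_inner, complete_space}"
  assumes e: "\<And>m n. e m \<bullet> e n = (if m = n then 1 else 0)"
    and c: "summable (\<lambda>n. (c n)\<^sup>2)" "(\<Sum>n. (c n)\<^sup>2) \<le> a\<^sup>2" "0 \<le> a"
    and d: "(\<Sum>n. ennreal ((d n)\<^sup>2)) \<le> ennreal (r\<^sup>2)" "0 \<le> r"
  shows "norm (\<Sum>n. (c n + d n) *\<^sub>R e n) \<le> a + r"
proof -
  note C = orthonormal_series[OF e c(1)]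
  have sd: "summable (\<lambda>n. (d n)\<^sup>2)" "(\<Sum>n. (d n)\<^sup>2) \<le> r\<^sup>2"
    using d(1) unfolding summable_sum_squares_iff by auto
  note D = orthonormal_series[OF e sd(1)]
  have "(\<Sum>n. (c n + d n) *\<^sub>R e n) = (\<Sum>n. c n *\<^sub>R e n) + (\<Sum>n. d n *\<^sub>R e n)"
    unfolding scaleR_add_left by (rule suminf_add[OF C(1) D(1), symmetric])
  moreover have "norm (\<Sum>n. c n *\<^sub>R e n) \<le> a"
    using C(2) c by (intro power2_le_imp_le[OF _ \<open>0 \<le> a\<close>]) simp
  moreover have "norm (\<Sum>n. d n *\<^sub>R e n) \<le> r"
    using D(2) sd by (intro power2_le_imp_le[OF _ \<open>0 \<le> r\<close>]) simp
  ultimately show ?thesis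
    using norm_triangle_ineq[of "\<Sum>n. c n *\<^sub>R e n" "\<Sum>n. d n *\<^sub>R e n"] by simp
qed

section \<open>Trajectories in \<open>L\<^sup>p\<close>\<close>

lemma Lp_interval_antimono:
  assumes f: "f \<in> Lp_interval q T" and "0 < p" "p \<le> q"
  shows "f \<in> Lp_interval p T"
proof -
  have [measurable]: "f \<in> borel_measurable (restrict_space lborel {0<..<T})"
    and fin: "(\<integral>\<^sup>+t\<in>{0<..<T}. ennreal (norm (f t) powr q) \<partial>lborel) < \<infinity>"
    using f by (auto simp: Lp_interval_def)
  have [simp]: "{0<..<T} \<inter> space lborel \<in> sets lborel" by simp
  let ?N = "restrict_space lborel {0<..<T}"
  have "(\<integral>\<^sup>+t\<in>{0<..<T}. ennreal (norm (f t) powr p) \<partial>lborel) = (\<integral>\<^sup>+t. ennreal (norm (f t) powr p) \<partial>?N)"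
    by (simp add: nn_integral_restrict_space)
  also have "\<dots> \<le> (\<integral>\<^sup>+t. 1 + ennreal (norm (f t) powr q) \<partial>?N)"
  proof (rule nn_integral_mono)
    fix t
    \<comment> \<open>The constant 1 takes care of the points with norm at most 1; it is integrable
      since the interval has finite length.\<close>
    have "norm (f t) powr p \<le> 1 + norm (f t) powr q"
    proof (cases "norm (f t) \<le> 1")
      case True
      then have "norm (f t) powr p \<le> 1 powr p"
        using \<open>0 < p\<close> by (intro powr_mono2) auto
      also have "1 powr p \<le> 1 + norm (f t) powr q"
        by simp
      finally show ?thesis .
    next
      case False
      then have "norm (f t) powr p \<le> norm (f t) powr q"
        using \<open>p \<le> q\<close> by (intro powr_mono) auto
      then show ?thesis by simp
    qed
    then have "ennreal (norm (f t) powr p) \<le> ennreal (1 + norm (f t) powr q)"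
      by (rule ennreal_leI)
    then show "ennreal (norm (f t) powr p) \<le> 1 + ennreal (norm (f t) powr q)"
      by (simp add: ennreal_plus)
  qed
  also have "\<dots> = emeasure ?N (space ?N) + (\<integral>\<^sup>+t. ennreal (norm (f t) powr q) \<partial>?N)"
    by (subst nn_integral_add) auto
  also have "\<dots> < \<infinity>"
  proof -
    have "emeasure ?N (space ?N) < \<infinity>"
      using emeasure_bounded_finite[OF bounded_box[of 0 T]]
      by (simp add: emeasure_restrict_space space_restrict_space)
    moreover have "(\<integral>\<^sup>+t. ennreal (norm (f t) powr q) \<partial>?N) < \<infinity>"
      using fin by (simp add: nn_integral_restrict_space)
    ultimately show ?thesis
      by simp
  qed
  finally show ?thesis
    by (simp add: Lp_interval_def)
qed

text \<open>By Fubini, a moment bound uniform in t makes the expected time integral over the bounded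
  interval finite, so the time integral is finite almost surely.\<close>

lemma AE_Lp_interval:
  fixes X :: "real \<Rightarrow> 'w \<Rightarrow> 'h::{real_normed_vector, second_countable_topology}"
  assumes "prob_space M" and X: "jointly_measurable M X"
    and bound: "\<And>t. 0 \<le> t \<Longrightarrow> (\<integral>\<^sup>+\<omega>. ennreal (norm (X t \<omega>) powr p) \<partial>M) \<le> ennreal B"
  shows "AE \<omega> in M. (\<lambda>t. X t \<omega>) \<in> Lp_interval p T"
proof -
  interpret prob_space M by fact
  let ?N = "restrict_space lborel {0<..<T}"
  have "sigma_finite_measure ?N"
    by (intro sigma_finite_measure_restrict_space sigma_finite_lborel) simp
  then interpret N: sigma_finite_measure ?N .
  interpret pair_sigma_finite ?N M ..
  \<comment> \<open>Joint measurability is given on the closed half-line; this inclusion transports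
    it to \<open>{0<..<T}\<close>.\<close>
  have id: "(\<lambda>t. t) \<in> ?N \<rightarrow>\<^sub>M restrict_space borel {0..}"
    by (rule measurable_restrict_space2) (auto simp: space_restrict_space intro: measurable_restrict_space1)
  have "(\<lambda>z. (fst z, snd z)) \<in> ?N \<Otimes>\<^sub>M M \<rightarrow>\<^sub>M restrict_space borel {0..} \<Otimes>\<^sub>M M"
    by (intro measurable_Pair measurable_compose[OF measurable_fst id] measurable_snd)
  from measurable_compose[OF this X[unfolded jointly_measurable_def]]
  have XN [measurable]: "(\<lambda>(t, \<omega>). X t \<omega>) \<in> borel_measurable (?N \<Otimes>\<^sub>M M)"
    by (simp add: case_prod_beta')
  have "(\<lambda>(t, \<omega>). ennreal (norm (X t \<omega>) powr p)) \<in> borel_measurable (?N \<Otimes>\<^sub>M M)"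
    by measurable
  from Fubini'[OF this]
  have "(\<integral>\<^sup>+\<omega>. (\<integral>\<^sup>+t. ennreal (norm (X t \<omega>) powr p) \<partial>?N) \<partial>M)
      = (\<integral>\<^sup>+t. (\<integral>\<^sup>+\<omega>. ennreal (norm (X t \<omega>) powr p) \<partial>M) \<partial>?N)"
    by simp
  also have "\<dots> \<le> (\<integral>\<^sup>+t. ennreal B \<partial>?N)"
    by (intro nn_integral_mono bound) (simp add: space_restrict_space)
  also have "\<dots> = ennreal B * emeasure lborel {0<..<T}"
    by (simp add: emeasure_restrict_space space_restrict_space)
  also have "\<dots> < \<infinity>"
    using emeasure_bounded_finite[OF bounded_box[of 0 T]] by (simp add: ennreal_mult_less_top)
  finally have fin: "(\<integral>\<^sup>+\<omega>. (\<integral>\<^sup>+t. ennreal (norm (X t \<omega>) powr p) \<partial>?N) \<partial>M) \<noteq> \<infinity>"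
    by simp
  have "AE \<omega> in M. (\<integral>\<^sup>+t. ennreal (norm (X t \<omega>) powr p) \<partial>?N) \<noteq> \<infinity>"
    by (rule nn_integral_PInf_AE[OF _ fin]) measurable
  then show ?thesis
    using AE_space
  proof eventually_elim
    case (elim \<omega>)
    have "(\<lambda>t. (t, \<omega>)) \<in> ?N \<rightarrow>\<^sub>M ?N \<Otimes>\<^sub>M M"
      using elim(2) by measurable
    from measurable_compose[OF this XN] elim(1) show ?case
      by (simp add: Lp_interval_def nn_integral_restrict_space top.not_eq_extremum)
  qed
qed

section \<open>The cylindrical Ornstein-Uhlenbeck process\<close>

text \<open>Fixes one choice of the integrals that \<open>ou_process\<close> only asserts to exist,
  so that all estimates refer to the same family I.\<close>

locale cylindrical_ou = prob_space M for M :: "'w measure" +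
  fixes F :: "real \<Rightarrow> 'w measure" and Z :: "nat \<Rightarrow> real \<Rightarrow> 'w \<Rightarrow> real" and \<alpha> :: real
    and \<beta> \<gamma> :: "nat \<Rightarrow> real" and e :: "nat \<Rightarrow> 'h::{real_inner, polish_space}"
    and x :: 'h and X :: "real \<Rightarrow> 'w \<Rightarrow> 'h" and I :: "nat \<Rightarrow> real \<Rightarrow> 'w \<Rightarrow> real"
  assumes basis: "stochastic_basis M F"
    and stable: "\<And>n. normalized_stable_levy \<alpha> M F (Z n)"
    and alpha_pos: "0 < \<alpha>"
    and beta_pos: "\<And>n. 0 < \<beta> n" and gamma_pos: "\<And>n. 0 < \<gamma> n"
    and summable_rates: "summable (\<lambda>n. \<beta> n powr \<alpha> / \<gamma> n)"
    and orthonormal: "\<And>m n. e m \<bullet> e n = (if m = n then 1 else 0)"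
    and X_measurable: "\<And>t. 0 \<le> t \<Longrightarrow> X t \<in> borel_measurable M"
    and I: "\<And>n t. 0 \<le> t \<Longrightarrow>
      has_stochastic_integral M (Z n) (\<lambda>s. exp (- \<gamma> n * (t - s)) * \<beta> n) 0 t (I n t)"
    and X: "\<And>t. 0 \<le> t \<Longrightarrow> AE \<omega> in M.
      X t \<omega> = (\<Sum>n. (exp (- \<gamma> n * t) * (x \<bullet> e n) + I n t \<omega>) *\<^sub>R e n)"
begin

section \<open>Tail bounds for the convolution and for the norm\<close>

lemma stable_levy: "stable_levy M F (Z n) \<alpha>"
  by unfold_locales (use basis stable alpha_pos in auto)

lemma I_measurable: "0 \<le> t \<Longrightarrow> I n t \<in> borel_measurable M"
  using I by (simp add: has_stochastic_integral_def)

text \<open>The integral over the half-line of the \<alpha>-th power of the kernel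
  \<open>\<beta> n * exp (- \<gamma> n * u)\<close>, a bound for the scale parameter of the n-th
  coordinate at every time.\<close>

definition \<kappa> :: "nat \<Rightarrow> real" where
  "\<kappa> n = \<beta> n powr \<alpha> / (\<alpha> * \<gamma> n)"

lemma kappa_nonneg: "0 \<le> \<kappa> n"
  using alpha_pos gamma_pos[of n] by (simp add: \<kappa>_def)

lemma summable_kappa: "summable \<kappa>"
  using summable_mult[OF summable_rates, of "1 / \<alpha>"] by (simp add: \<kappa>_def[abs_def])

lemma emeasure_convolution_tail:
  assumes "0 \<le> t" "0 < r"
  shows "emeasure M {\<omega>\<in>space M. ennreal (r\<^sup>2) < (\<Sum>n. ennreal ((I n t \<omega>)\<^sup>2))}
    \<le> ennreal (8 * (r powr - \<alpha> * suminf \<kappa>))"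
proof -
  have "emeasure M {\<omega>\<in>space M. ennreal (r\<^sup>2) < (\<Sum>n. ennreal ((I n t \<omega>)\<^sup>2))}
      \<le> ennreal (\<Sum>n. 8 * (r powr - \<alpha> * \<kappa> n))"
  proof (rule emeasure_sum_squares_gt[OF I_measurable[OF assms(1)] assms(2)])
    show "summable (\<lambda>n. 8 * (r powr - \<alpha> * \<kappa> n))"
      by (intro summable_mult summable_kappa)
    show "(\<integral>\<^sup>+\<omega>. ennreal (trunc_sq (I n t \<omega> / r)) \<partial>M) \<le> ennreal (8 * (r powr - \<alpha> * \<kappa> n))" for n
      unfolding \<kappa>_def
      using stable_levy.nn_integral_ou_integral[OF stable_levy I[OF assms(1)] assms beta_pos gamma_pos] .
    show "0 \<le> 8 * (r powr - \<alpha> * \<kappa> n)" for n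
      using kappa_nonneg by simp
  qed
  also have "(\<Sum>n. 8 * (r powr - \<alpha> * \<kappa> n)) = 8 * (r powr - \<alpha> * suminf \<kappa>)"
    using summable_kappa by (simp add: suminf_mult summable_mult)
  finally show ?thesis .
qed

text \<open>Divergence of the series lies in every tail event, and the tail bounds tend to 0 along
  the levels \<open>Suc k\<close>.\<close>

lemma AE_summable_convolution:
  assumes "0 \<le> t"
  shows "AE \<omega> in M. summable (\<lambda>n. (I n t \<omega>)\<^sup>2)"
proof -
  have [measurable]: "I n t \<in> borel_measurable M" for n
    using assms by (rule I_measurable)
  let ?A = "{\<omega>\<in>space M. (\<Sum>n. ennreal ((I n t \<omega>)\<^sup>2)) = \<top>}"
  have "(\<lambda>k. 8 * (real (Suc k) powr - \<alpha> * suminf \<kappa>)) \<longlonglongrightarrow> 8 * (0 * suminf \<kappa>)"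
    using alpha_pos
    by (intro tendsto_mult tendsto_const tendsto_neg_powr filterlim_compose[OF filterlim_real_sequentially filterlim_Suc]) auto
  then have "(\<lambda>k. ennreal (8 * (real (Suc k) powr - \<alpha> * suminf \<kappa>))) \<longlonglongrightarrow> ennreal 0"
    by (intro tendsto_ennrealI) simp
  moreover have "emeasure M ?A \<le> ennreal (8 * (real (Suc k) powr - \<alpha> * suminf \<kappa>))" for k
  proof -
    have "emeasure M ?A \<le> emeasure M {\<omega>\<in>space M. ennreal ((real (Suc k))\<^sup>2) < (\<Sum>n. ennreal ((I n t \<omega>)\<^sup>2))}"
      by (intro emeasure_mono) auto
    also have "\<dots> \<le> ennreal (8 * (real (Suc k) powr - \<alpha> * suminf \<kappa>))"
      using assms by (intro emeasure_convolution_tail) auto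
    finally show ?thesis .
  qed
  ultimately have "emeasure M ?A \<le> ennreal 0"
    by (intro LIMSEQ_le_const) auto
  then have "AE \<omega> in M. (\<Sum>n. ennreal ((I n t \<omega>)\<^sup>2)) \<noteq> \<top>"
    by (intro AE_I[of _ _ ?A]) auto
  then show ?thesis
    by eventually_elim (auto intro: summable_suminf_not_top)
qed

lemma initial_value_bessel:
  assumes "0 \<le> t"
  shows "summable (\<lambda>n. (exp (- \<gamma> n * t) * (x \<bullet> e n))\<^sup>2)"
    "(\<Sum>n. (exp (- \<gamma> n * t) * (x \<bullet> e n))\<^sup>2) \<le> (norm x)\<^sup>2"
proof -
  note B = bessel_inequality[OF orthonormal, of x]
  have le: "(exp (- \<gamma> n * t) * (x \<bullet> e n))\<^sup>2 \<le> (x \<bullet> e n)\<^sup>2" for n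
  proof -
    have "exp (- \<gamma> n * t) \<le> 1"
      using assms gamma_pos[of n] by simp
    then have "(exp (- \<gamma> n * t))\<^sup>2 \<le> 1"
      by (simp add: power_le_one)
    then show ?thesis
      unfolding power_mult_distrib by (rule mult_left_le_one_le[rotated 2]) auto
  qed
  then show sm: "summable (\<lambda>n. (exp (- \<gamma> n * t) * (x \<bullet> e n))\<^sup>2)"
    by (intro summable_comparison_test'[OF B(1), of 0]) auto
  show "(\<Sum>n. (exp (- \<gamma> n * t) * (x \<bullet> e n))\<^sup>2) \<le> (norm x)\<^sup>2"
    using suminf_le[OF le sm B(1)] B(2) by simp
qed

text \<open>The deterministic part has norm at most \<open>norm x\<close>. If this exceeds
  \<open>r / 2\<close>, the right side is at least 1. Otherwise \<open>norm (X t \<omega>)\<close>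
  can exceed r only if the convolution exceeds \<open>r / 2\<close>, up to a null set.\<close>

lemma emeasure_norm_tail:
  assumes "0 \<le> t" "0 < r"
  shows "emeasure M {\<omega>\<in>space M. r < norm (X t \<omega>)}
    \<le> ennreal (2 powr \<alpha> * (8 * suminf \<kappa> + norm x powr \<alpha>) * r powr - \<alpha>)"
proof -
  have [measurable]: "I n t \<in> borel_measurable M" "X t \<in> borel_measurable M" for n
    using assms by (auto intro: I_measurable X_measurable)
  have kappa: "0 \<le> suminf \<kappa>"
    using summable_kappa kappa_nonneg by (rule suminf_nonneg)
  have half: "(r / 2) powr - \<alpha> = 2 powr \<alpha> * r powr - \<alpha>"
    using assms by (simp add: powr_divide powr_minus divide_simps)
  show ?thesis
  proof (cases "r / 2 < norm x")
    case True
    have "1 = (r / 2) powr \<alpha> * (r / 2) powr - \<alpha>"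
      using assms by (simp flip: powr_add)
    also have "\<dots> \<le> norm x powr \<alpha> * (r / 2) powr - \<alpha>"
      using True assms alpha_pos by (intro mult_right_mono powr_mono2) auto
    also have "\<dots> \<le> 2 powr \<alpha> * (8 * suminf \<kappa> + norm x powr \<alpha>) * r powr - \<alpha>"
      unfolding half using kappa by (simp add: algebra_simps)
    finally have "1 \<le> ennreal (2 powr \<alpha> * (8 * suminf \<kappa> + norm x powr \<alpha>) * r powr - \<alpha>)"
      by simp
    then show ?thesis
      using emeasure_le_1 by (rule order_trans[rotated])
  next
    case False
    have "emeasure M {\<omega>\<in>space M. r < norm (X t \<omega>)}
        \<le> emeasure M {\<omega>\<in>space M. ennreal ((r / 2)\<^sup>2) < (\<Sum>n. ennreal ((I n t \<omega>)\<^sup>2))}"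
    proof (rule emeasure_mono_AE)
      show "AE \<omega> in M. \<omega> \<in> {\<omega>\<in>space M. r < norm (X t \<omega>)} \<longrightarrow>
          \<omega> \<in> {\<omega>\<in>space M. ennreal ((r / 2)\<^sup>2) < (\<Sum>n. ennreal ((I n t \<omega>)\<^sup>2))}"
        using X[OF assms(1)]
      proof eventually_elim
        case (elim \<omega>)
        have le: "norm (X t \<omega>) \<le> norm x + r / 2" if "(\<Sum>n. ennreal ((I n t \<omega>)\<^sup>2)) \<le> ennreal ((r / 2)\<^sup>2)"
          unfolding elim using assms that
          by (intro orthonormal_series_norm_le orthonormal initial_value_bessel) auto
        have "ennreal ((r / 2)\<^sup>2) < (\<Sum>n. ennreal ((I n t \<omega>)\<^sup>2))" if "r < norm (X t \<omega>)"
        proof (rule ccontr)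
          assume "\<not> ?thesis"
          then have "norm (X t \<omega>) \<le> norm x + r / 2"
            by (intro le) (simp add: not_less)
          with that False show False by linarith
        qed
        then show ?case by auto
      qed
    qed measurable
    also have "\<dots> \<le> ennreal (8 * ((r / 2) powr - \<alpha> * suminf \<kappa>))"
      using assms by (intro emeasure_convolution_tail) auto
    also have "\<dots> \<le> ennreal (2 powr \<alpha> * (8 * suminf \<kappa> + norm x powr \<alpha>) * r powr - \<alpha>)"
      unfolding half by (intro ennreal_leI) (simp add: algebra_simps)
    finally show ?thesis .
  qed
qed

text \<open>The null set must serve all p at once, so the moment bound is used along a sequence of
  exponents tending to \<alpha>, and smaller exponents follow from
  \<open>Lp_interval_antimono\<close>.\<close>

theorem AE_trajectories_Lp:
  assumes "jointly_measurable M X"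
  shows "AE \<omega> in M. \<forall>p. 0 < p \<and> p < \<alpha> \<longrightarrow> (\<lambda>t. X t \<omega>) \<in> Lp_interval p T"
proof -
  \<comment> \<open>The double successor keeps \<open>q 0\<close> positive; it equals
    \<open>\<alpha> / 2\<close>.\<close>
  define q where "q k = \<alpha> * (1 - inverse (real (Suc (Suc k))))" for k
  have q: "0 < q k" "q k < \<alpha>" for k
  proof -
    have "inverse (real (Suc (Suc k))) < 1" "0 < inverse (real (Suc (Suc k)))"
      by (auto simp: field_simps)
    then show "0 < q k" "q k < \<alpha>"
      using alpha_pos by (simp_all add: q_def zero_less_mult_iff mult_less_cancel_left2)
  qed
  have kappa: "0 \<le> suminf \<kappa>"
    using summable_kappa kappa_nonneg by (rule suminf_nonneg)
  have "AE \<omega> in M. (\<lambda>t. X t \<omega>) \<in> Lp_interval (q k) T" for k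
  proof (rule AE_Lp_interval[OF prob_space_axioms assms])
    fix t :: real assume "0 \<le> t"
    note [measurable] = X_measurable[OF this]
    show "(\<integral>\<^sup>+\<omega>. ennreal (norm (X t \<omega>) powr q k) \<partial>M) \<le> ennreal (\<Sum>m. if m = 0 then 1
        else 2 powr \<alpha> * (8 * suminf \<kappa> + norm x powr \<alpha>) * real m powr (- \<alpha> / q k))"
      using \<open>0 \<le> t\<close> q kappa
      by (intro nn_integral_powr_le_of_tail emeasure_norm_tail) auto
  qed
  then have "AE \<omega> in M. \<forall>k. (\<lambda>t. X t \<omega>) \<in> Lp_interval (q k) T"
    by (simp add: AE_all_countable)
  then show ?thesis
  proof eventually_elim
    case (elim \<omega>)
    show ?case
    proof (intro allI impI)
      fix p assume p: "0 < p \<and> p < \<alpha>"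
      then have "0 < 1 - p / \<alpha>"
        using alpha_pos by simp
      then obtain k where "inverse (real (Suc k)) < 1 - p / \<alpha>"
        using reals_Archimedean by blast
      moreover have "inverse (real (Suc (Suc k))) \<le> inverse (real (Suc k))"
        by (intro le_imp_inverse_le) auto
      ultimately have "p / \<alpha> \<le> 1 - inverse (real (Suc (Suc k)))"
        by linarith
      then have "p \<le> q k"
        using alpha_pos by (simp add: q_def field_simps)
      with elim p show "(\<lambda>t. X t \<omega>) \<in> Lp_interval p T"
        by (blast intro: Lp_interval_antimono)
    qed
  qed
qed

text \<open>The bracket of \<open>nn_integral_ou_increment\<close>, with the absolute value so that
  s may lie on either side of t.\<close>

definition \<theta> :: "nat \<Rightarrow> real \<Rightarrow> real" where
  "\<theta> n u = (1 - exp (- \<gamma> n * \<bar>u\<bar>)) powr \<alpha> + (1 - exp (- (\<alpha> * \<gamma> n) * \<bar>u\<bar>))"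

lemma theta_nonneg: "0 \<le> \<theta> n u" and theta_le_2: "\<theta> n u \<le> 2"
proof -
  have g: "0 < \<gamma> n" "0 < \<alpha> * \<gamma> n"
    using gamma_pos[of n] alpha_pos by auto
  then have *: "0 \<le> 1 - exp (- \<gamma> n * \<bar>u\<bar>)" "0 \<le> 1 - exp (- (\<alpha> * \<gamma> n) * \<bar>u\<bar>)"
    by auto
  then show "0 \<le> \<theta> n u"
    by (simp add: \<theta>_def)
  have "(1 - exp (- \<gamma> n * \<bar>u\<bar>)) powr \<alpha> \<le> 1 powr \<alpha>"
    using * alpha_pos by (intro powr_mono2) auto
  moreover have "1 - exp (- (\<alpha> * \<gamma> n) * \<bar>u\<bar>) \<le> 1"
    by simp
  ultimately show "\<theta> n u \<le> 2"
    unfolding \<theta>_def powr_one_eq_one by linarith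
qed

lemma tendsto_theta: "((\<lambda>s. \<theta> n (s - t)) \<longlongrightarrow> 0) (at t within S)"
proof -
  have "((\<lambda>s. \<theta> n (s - t)) \<longlongrightarrow> (1 - exp (- \<gamma> n * \<bar>t - t\<bar>)) powr \<alpha> + (1 - exp (- (\<alpha> * \<gamma> n) * \<bar>t - t\<bar>)))
      (at t within S)"
    \<comment> \<open>The power is continuous even at base 0, since the base stays nonnegative and
      the exponent is positive.\<close>
    unfolding \<theta>_def using gamma_pos[of n] alpha_pos
    by (intro tendsto_intros tendsto_powr2 always_eventually) auto
  then show ?thesis by simp
qed

lemma nn_integral_increment:
  assumes "0 \<le> s" "0 \<le> t" "0 < r"
  shows "(\<integral>\<^sup>+\<omega>. ennreal (trunc_sq ((I n s \<omega> - I n t \<omega>) / r)) \<partial>M)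
    \<le> ennreal (8 * (r powr - \<alpha> * (\<kappa> n * \<theta> n (s - t))))"
proof -
  have le: "(\<integral>\<^sup>+\<omega>. ennreal (trunc_sq ((I n s \<omega> - I n t \<omega>) / r)) \<partial>M)
      \<le> ennreal (8 * (r powr - \<alpha> * (\<kappa> n * \<theta> n (s - t))))" if "0 \<le> t" "t \<le> s" for s t
    using stable_levy.nn_integral_ou_increment[OF stable_levy I[where n = n and t = s] I[where n = n and t = t]
        that \<open>0 < r\<close> beta_pos gamma_pos] that
    by (simp add: \<kappa>_def \<theta>_def)
  show ?thesis
  proof (cases "t \<le> s")
    case True
    then show ?thesis using le assms by simp
  next
    case False
    have "trunc_sq ((I n s \<omega> - I n t \<omega>) / r) = trunc_sq ((I n t \<omega> - I n s \<omega>) / r)" for \<omega>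
      by (metis minus_diff_eq minus_divide_left trunc_sq_minus)
    moreover have "\<theta> n (s - t) = \<theta> n (t - s)"
      by (simp add: \<theta>_def abs_minus_commute)
    ultimately show ?thesis using le[of s t] assms False by simp
  qed
qed

text \<open>The increment splits into a deterministic part c and a random part. By dominated
  summation c is eventually below \<open>\<epsilon> / 2\<close> in norm, so only the random part can
  cause a deviation. Its tail bound is a series whose terms vanish at t and which
  \<open>\<theta> n u \<le> 2\<close> dominates by a multiple of \<kappa>.\<close>

theorem stochastically_continuous: "stochastically_continuous M X"
  unfolding stochastically_continuous_def
proof (intro allI impI)
  fix t \<epsilon> :: real assume "0 \<le> t" "0 < \<epsilon>"
  define r where "r = \<epsilon> / 2"
  have "0 < r" using \<open>0 < \<epsilon>\<close> by (simp add: r_def)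
  define c where "c n s = (exp (- \<gamma> n * s) - exp (- \<gamma> n * t)) * (x \<bullet> e n)" for n s
  define b where "b n s = 8 * (r powr - \<alpha> * (\<kappa> n * \<theta> n (s - t)))" for n s
  let ?F = "at t within {0..}"
  have nonneg: "\<forall>\<^sub>F s in ?F. 0 \<le> s"
    by (simp add: eventually_at_filter)
  note B = bessel_inequality[OF orthonormal, of x]
  have c_le: "(c n s)\<^sup>2 \<le> (x \<bullet> e n)\<^sup>2" if "0 \<le> s" for n s
  proof -
    have "exp (- \<gamma> n * s) \<le> 1" "exp (- \<gamma> n * t) \<le> 1"
      using that \<open>0 \<le> t\<close> gamma_pos[of n] by auto
    then have "\<bar>exp (- \<gamma> n * s) - exp (- \<gamma> n * t)\<bar> \<le> 1"
      using exp_gt_zero[of "- \<gamma> n * s"] exp_gt_zero[of "- \<gamma> n * t"] by linarith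
    then have "(exp (- \<gamma> n * s) - exp (- \<gamma> n * t))\<^sup>2 \<le> 1"
      by (simp add: abs_square_le_1)
    then show ?thesis
      unfolding c_def power_mult_distrib by (rule mult_left_le_one_le[rotated 2]) auto
  qed
  have c_summable: "summable (\<lambda>n. (c n s)\<^sup>2)" if "0 \<le> s" for s
    using c_le[OF that] by (intro summable_comparison_test'[OF B(1), of 0]) auto
  have "((\<lambda>s. \<Sum>n. (c n s)\<^sup>2) \<longlongrightarrow> 0) ?F"
  proof (rule tendsto_suminf_dominated[OF _ _ B(1)])
    fix n
    have "((\<lambda>s. (c n s)\<^sup>2) \<longlongrightarrow> ((exp (- \<gamma> n * t) - exp (- \<gamma> n * t)) * (x \<bullet> e n))\<^sup>2) ?F"
      unfolding c_def by (intro tendsto_intros)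
    then show "((\<lambda>s. (c n s)\<^sup>2) \<longlongrightarrow> 0) ?F" by simp
  next
    show "\<forall>\<^sub>F s in ?F. \<forall>n. norm ((c n s)\<^sup>2) \<le> (x \<bullet> e n)\<^sup>2"
      using nonneg by eventually_elim (simp add: c_le)
  qed
  then have c_small: "\<forall>\<^sub>F s in ?F. (\<Sum>n. (c n s)\<^sup>2) < r\<^sup>2"
    using \<open>0 < r\<close> by (intro order_tendstoD) auto
  have b_nonneg: "0 \<le> b n s" for n s
    by (simp add: b_def kappa_nonneg theta_nonneg)
  have b_le: "b n s \<le> 8 * (r powr - \<alpha> * (\<kappa> n * 2))" for n s
    unfolding b_def by (intro mult_left_mono theta_le_2 kappa_nonneg) auto
  have b_dom: "summable (\<lambda>n. 8 * (r powr - \<alpha> * (\<kappa> n * 2)))"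
    by (intro summable_mult summable_mult2 summable_kappa)
  have b_summable: "summable (\<lambda>n. b n s)" for s
    using b_le b_nonneg by (intro summable_comparison_test'[OF b_dom, of 0]) auto
  have b_lim: "((\<lambda>s. \<Sum>n. b n s) \<longlongrightarrow> 0) ?F"
  proof (rule tendsto_suminf_dominated[OF _ _ b_dom])
    fix n
    have "((\<lambda>s. b n s) \<longlongrightarrow> 8 * (r powr - \<alpha> * (\<kappa> n * 0))) ?F"
      unfolding b_def by (intro tendsto_intros tendsto_theta)
    then show "((\<lambda>s. b n s) \<longlongrightarrow> 0) ?F" by simp
  qed (use b_le b_nonneg in auto)
  have prob_le: "\<forall>\<^sub>F s in ?F. prob {\<omega>\<in>space M. dist (X s \<omega>) (X t \<omega>) > \<epsilon>} \<le> (\<Sum>n. b n s)"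
    using nonneg c_small
  proof eventually_elim
    case (elim s)
    have [measurable]: "I n t \<in> borel_measurable M" "X t \<in> borel_measurable M"
        "I n s \<in> borel_measurable M" "X s \<in> borel_measurable M" for n
      using elim \<open>0 \<le> t\<close> by (auto intro: I_measurable X_measurable)
    let ?A = "{\<omega>\<in>space M. ennreal (r\<^sup>2) < (\<Sum>n. ennreal ((I n s \<omega> - I n t \<omega>)\<^sup>2))}"
    have "emeasure M {\<omega>\<in>space M. dist (X s \<omega>) (X t \<omega>) > \<epsilon>} \<le> emeasure M ?A"
    proof (rule emeasure_mono_AE)
      show "AE \<omega> in M. \<omega> \<in> {\<omega>\<in>space M. dist (X s \<omega>) (X t \<omega>) > \<epsilon>} \<longrightarrow> \<omega> \<in> ?A"
        using X[OF elim(1)] X[OF \<open>0 \<le> t\<close>]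
          AE_summable_convolution[OF elim(1)] AE_summable_convolution[OF \<open>0 \<le> t\<close>]
      proof eventually_elim
        fix \<omega>
        assume Xs: "X s \<omega> = (\<Sum>n. (exp (- \<gamma> n * s) * (x \<bullet> e n) + I n s \<omega>) *\<^sub>R e n)"
          and Xt: "X t \<omega> = (\<Sum>n. (exp (- \<gamma> n * t) * (x \<bullet> e n) + I n t \<omega>) *\<^sub>R e n)"
          and Is: "summable (\<lambda>n. (I n s \<omega>)\<^sup>2)" and It: "summable (\<lambda>n. (I n t \<omega>)\<^sup>2)"
        \<comment> \<open>Convergence of both series has to be known before they may be subtracted
          termwise.\<close>
        have series: "summable (\<lambda>n. (exp (- \<gamma> n * u) * (x \<bullet> e n) + I n u \<omega>) *\<^sub>R e n)"
          if "0 \<le> u" "summable (\<lambda>n. (I n u \<omega>)\<^sup>2)" for u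
          unfolding scaleR_add_left using that
          by (intro summable_add orthonormal_series(1)[OF orthonormal] initial_value_bessel)
        have "X s \<omega> - X t \<omega> = (\<Sum>n. (c n s + (I n s \<omega> - I n t \<omega>)) *\<^sub>R e n)"
          unfolding Xs Xt suminf_diff[OF series[OF elim(1) Is] series[OF \<open>0 \<le> t\<close> It]]
          by (simp add: c_def algebra_simps)
        then have "dist (X s \<omega>) (X t \<omega>) = norm (\<Sum>n. (c n s + (I n s \<omega> - I n t \<omega>)) *\<^sub>R e n)"
          by (simp add: dist_norm)
        moreover have "norm (\<Sum>n. (c n s + (I n s \<omega> - I n t \<omega>)) *\<^sub>R e n) \<le> r + r"
          if "(\<Sum>n. ennreal ((I n s \<omega> - I n t \<omega>)\<^sup>2)) \<le> ennreal (r\<^sup>2)"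
          using elim \<open>0 < r\<close> that c_summable[of s]
          by (intro orthonormal_series_norm_le orthonormal) auto
        ultimately have "ennreal (r\<^sup>2) < (\<Sum>n. ennreal ((I n s \<omega> - I n t \<omega>)\<^sup>2))"
          if "dist (X s \<omega>) (X t \<omega>) > \<epsilon>"
          using that by (intro not_le_imp_less notI) (simp add: r_def)
        then show "\<omega> \<in> {\<omega>\<in>space M. dist (X s \<omega>) (X t \<omega>) > \<epsilon>} \<longrightarrow> \<omega> \<in> ?A"
          by auto
      qed
    qed measurable
    also have "\<dots> \<le> ennreal (\<Sum>n. b n s)"
    proof (rule emeasure_sum_squares_gt[OF _ \<open>0 < r\<close> b_summable _ b_nonneg])
      show "(\<integral>\<^sup>+\<omega>. ennreal (trunc_sq ((I n s \<omega> - I n t \<omega>) / r)) \<partial>M) \<le> ennreal (b n s)" for n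
        unfolding b_def using elim(1) \<open>0 \<le> t\<close> \<open>0 < r\<close> by (rule nn_integral_increment)
    qed measurable
    finally show ?case
      using b_summable b_nonneg by (simp add: emeasure_eq_measure suminf_nonneg)
  qed
  show "((\<lambda>s. prob {\<omega>\<in>space M. dist (X s \<omega>) (X t \<omega>) > \<epsilon>}) \<longlongrightarrow> 0) ?F"
    by (rule tendsto_sandwich[OF always_eventually prob_le tendsto_const b_lim]) simp
qed

end

lemma ou_process_imp_cylindrical_ou:
  fixes e :: "nat \<Rightarrow> 'h::{real_inner, polish_space}"
  assumes "ou_process M e \<gamma> \<beta> Z x X"
    and "orthonormal_basis e" "0 < \<alpha>" "stochastic_basis M F"
    and "\<And>n. normalized_stable_levy \<alpha> M F (Z n)" "\<And>n. 0 < \<beta> n" "\<And>n. 0 < \<gamma> n"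
    and "summable (\<lambda>n. \<beta> n powr \<alpha> / \<gamma> n)"
  obtains I where "cylindrical_ou M F Z \<alpha> \<beta> \<gamma> e x X I"
proof -
  obtain I where
    "\<And>n t. 0 \<le> t \<Longrightarrow> has_stochastic_integral M (Z n) (\<lambda>s. exp (- \<gamma> n * (t - s)) * \<beta> n) 0 t (I n t)"
    "\<And>t. 0 \<le> t \<Longrightarrow> AE \<omega> in M. X t \<omega> = (\<Sum>n. (exp (- \<gamma> n * t) * (x \<bullet> e n) + I n t \<omega>) *\<^sub>R e n)"
    using assms(1) unfolding ou_process_def by blast
  moreover have "prob_space M"
    using assms(4) unfolding stochastic_basis_def by (elim conjE)
  ultimately have "cylindrical_ou M F Z \<alpha> \<beta> \<gamma> e x X I"
    using assms unfolding cylindrical_ou_def cylindrical_ou_axioms_def orthonormal_basis_def ou_process_def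
    by blast
  then show thesis by (rule that)
qed

theorem theorem4p5:
  fixes M :: "'w measure" and F :: "real \<Rightarrow> 'w measure"
    and e :: "nat \<Rightarrow> 'h::{real_inner, polish_space}"
    and D :: "'h set" and A :: "'h \<Rightarrow> 'h"
    and \<alpha> :: real and \<beta> \<gamma> :: "nat \<Rightarrow> real"
    and Z :: "nat \<Rightarrow> real \<Rightarrow> 'w \<Rightarrow> real"
  assumes "orthonormal_basis e"
    and "0 < \<alpha>" and "\<alpha> < 2"
    and "stochastic_basis M F"
    and "\<And>n. normalized_stable_levy \<alpha> M F (Z n)"
    and "independent_processes M Z"
    and "\<And>n. \<beta> n > 0"
    and "self_adjoint_operator D A"
    and "\<And>n. e n \<in> D"
    and "\<And>n. A (e n) = - \<gamma> n *\<^sub>R e n"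
    and "\<And>n. \<gamma> n > 0"
    and "filterlim \<gamma> at_top sequentially"
    and "summable (\<lambda>n. \<beta> n powr \<alpha> / \<gamma> n)"
  shows "(\<forall>x X. ou_process M e \<gamma> \<beta> Z x X \<longrightarrow> stochastically_continuous M X) \<and>
         (\<forall>x X T. ou_process M e \<gamma> \<beta> Z x X \<and> jointly_measurable M X \<and> T > 0 \<longrightarrow>
            (AE \<omega> in M. \<forall>p. 0 < p \<and> p < \<alpha> \<longrightarrow> (\<lambda>t. X t \<omega>) \<in> Lp_interval p T))"
proof (intro conjI allI impI)
  fix x X assume "ou_process M e \<gamma> \<beta> Z x X"
  then obtain I where "cylindrical_ou M F Z \<alpha> \<beta> \<gamma> e x X I"
    by (rule ou_process_imp_cylindrical_ou[where Z = Z, OF _ assms(1,2,4,5,7,11,13)])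
  then show "stochastically_continuous M X"
    by (rule cylindrical_ou.stochastically_continuous)
next
  fix x X and T :: real
  assume X: "ou_process M e \<gamma> \<beta> Z x X \<and> jointly_measurable M X \<and> T > 0"
  then obtain I where "cylindrical_ou M F Z \<alpha> \<beta> \<gamma> e x X I"
    using ou_process_imp_cylindrical_ou[where Z = Z, OF _ assms(1,2,4,5,7,11,13)] by blast
  then show "AE \<omega> in M. \<forall>p. 0 < p \<and> p < \<alpha> \<longrightarrow> (\<lambda>t. X t \<omega>) \<in> Lp_interval p T"
    using X by (intro cylindrical_ou.AE_trajectories_Lp) auto
qed

end
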